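(* Let $R$ be a complete local Noetherian $F$-finite domain of characteristic $p>0$, let $\mathfrak a, J\subseteq R$ be proper nonzero ideals with $\mathfrak a\subseteq\sqrt J$, and let $B$ be a BCM $R^+$-algebra which captures tight closure for $R$. If $R$ is weakly $F$-regular, then $c^J_B(\mathfrak a)=c^J(\mathfrak a)$, i.e. the BCM-threshold of $\mathfrak a$ with respect to $J$ along $B$ coincides with the classical $F$-threshold.
   Context: $R^+$ denotes an absolute integral closure of the domain $R$ (the integral closure of $R$ in a fixed algebraic closure of its fraction field $K(R)$). A valuation $v$ of $K(A)$ "over" a domain $A$ is a valuation (arbitrary ordered value group, $v(0)=\infty$) that is nonnegative on $A$. Fractional powers. For an ideal $I\subseteq R^+$ and rational $q\ge 0$, $I_q$ is the ideal of all $x\in R^+$ such that for each valuation $v$ of $K(R^+)$ over $R^+$ there is $y\in I$ with $v(x)\ge q\,v(y)$ (inequality in the divisible hull of the value group). For an ideal $\mathfrak a\subseteq R$ and real $t\ge 0$, $(\mathfrak aR^+)_{>t}:=\bigcup_{q\in\mathbb Q,\,q>t}(\mathfrak aR^+)_q$. A (balanced) big Cohen–Macaulay (BCM) $R$-algebra is an $R$-algebra $B$ such that every system of parameters of $R$ is a regular sequence on $B$ (in particular $\mathfrak mB\ne B$); a BCM $R^+$-algebra is an $R^+$-algebra that is BCM over $R$. The BCM-threshold is $c_B^J(\mathfrak a):=\sup\{t\in\mathbb R_{\ge0}\mid(\mathfrak aR^+)_{>t}\not\subseteq JB\}=\inf\{t\in\mathbb R_{\ge0}\mid(\mathfrak aR^+)_{>t}\subseteq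 JB\}$, where $\subseteq JB$ refers to images in $B$. $B$ captures tight closure for $R$ if $(IB)\cap R=I^*$ for all ideals $I\subseteq R$, where $I^*$ is the tight closure and $(IB)\cap R$ is the preimage of $IB$ in $R$. $R$ is weakly $F$-regular if $I^*=I$ for all ideals $I$. The classical $F$-threshold is $c^J(\mathfrak a)=\lim_{e\to\infty}\nu^J_{\mathfrak a}(p^e)/p^e$, where $\nu^J_{\mathfrak a}(p^e)=\max\{n>0\mid\mathfrak a^n\not\subseteq J^{[p^e]}\}$ and $J^{[p^e]}$ is the ideal generated by the $p^e$-th powers of elements of $J$ (the limit exists). *)

theory Defs
  imports "HOL-Algebra.Algebra" "HOL-Computational_Algebra.Primes" "HOL-Library.Extended_Nonnegative_Real"
begin

section \<open>Valuations with values in an arbitrary ordered abelian group\<close>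

text \<open>
  Value groups are written multiplicatively, as always in HOL-Algebra, together with a linear
  order \<^term>\<open>r\<close> on the carrier. A value is an element of \<^typ>\<open>'g option\<close>, where \<^const>\<open>None\<close>
  stands for infinity.
\<close>

definition ext_le :: "('g \<times> 'g) set \<Rightarrow> 'g option \<Rightarrow> 'g option \<Rightarrow> bool" where
  "ext_le r a b \<longleftrightarrow> b = None \<or> (\<exists>g h. a = Some g \<and> b = Some h \<and> (g, h) \<in> r)"

definition ext_add :: "('g, 'n) monoid_scheme \<Rightarrow> 'g option \<Rightarrow> 'g option \<Rightarrow> 'g option" where
  "ext_add G a b = (case (a, b) of (Some g, Some h) \<Rightarrow> Some (g \<otimes>\<^bsub>G\<^esub> h) | _ \<Rightarrow> None)"

primrec ext_nmul :: "('g, 'n) monoid_scheme \<Rightarrow> nat \<Rightarrow> 'g option \<Rightarrow> 'g option" where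
  "ext_nmul G 0 a = Some \<one>\<^bsub>G\<^esub>"
| "ext_nmul G (Suc n) a = ext_add G (ext_nmul G n a) a"

text \<open>
  The inequality \<open>q a \<le> b\<close> in the divisible hull of the value group: for \<open>q = m / n\<close> it means
  \<open>m a \<le> n b\<close>. The value groups are torsion-free and ordered, so it does not matter which
  fraction represents \<open>q\<close>.
\<close>

definition rat_mul_le ::
    "('g, 'n) monoid_scheme \<Rightarrow> ('g \<times> 'g) set \<Rightarrow> rat \<Rightarrow> 'g option \<Rightarrow> 'g option \<Rightarrow> bool" where
  "rat_mul_le G r q a b \<longleftrightarrow>
     (\<exists>m n::nat. 0 < n \<and> q = of_nat m / of_nat n \<and> ext_le r (ext_nmul G m a) (ext_nmul G n b))"

locale ordered_comm_group = comm_group G for G :: "('g, 'n) monoid_scheme" (structure) +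
  fixes r :: "('g \<times> 'g) set"
  assumes linear_order: "linear_order_on (carrier G) r"
    and mult_mono: "\<lbrakk>(g, h) \<in> r; k \<in> carrier G\<rbrakk> \<Longrightarrow> (g \<otimes> k, h \<otimes> k) \<in> r"

locale field_valuation = F: field F + G: ordered_comm_group G r
  for F :: "('l, 'k) ring_scheme" and G :: "('g, 'n) monoid_scheme" and r +
  fixes v :: "'l \<Rightarrow> 'g option"
  assumes v_zero: "v \<zero>\<^bsub>F\<^esub> = None"
    and v_nonzero: "x \<in> carrier F - {\<zero>\<^bsub>F\<^esub>} \<Longrightarrow> v x \<in> Some ` carrier G"
    and v_mult: "\<lbrakk>x \<in> carrier F; y \<in> carrier F\<rbrakk> \<Longrightarrow> v (x \<otimes>\<^bsub>F\<^esub> y) = ext_add G (v x) (v y)"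
    and v_add: "\<lbrakk>x \<in> carrier F; y \<in> carrier F\<rbrakk>
                  \<Longrightarrow> ext_le r (v x) (v (x \<oplus>\<^bsub>F\<^esub> y)) \<or> ext_le r (v y) (v (x \<oplus>\<^bsub>F\<^esub> y))"

definition nonneg_on ::
    "('g, 'n) monoid_scheme \<Rightarrow> ('g \<times> 'g) set \<Rightarrow> ('l \<Rightarrow> 'g option) \<Rightarrow> 'l set \<Rightarrow> bool" where
  "nonneg_on G r v A \<longleftrightarrow> (\<forall>x\<in>A. ext_le r (Some \<one>\<^bsub>G\<^esub>) (v x))"

text \<open>
  The next lemma shows that quantifying over all valuations whose value group lives on the type
  \<^typ>\<open>'l set\<close> (for a field on \<^typ>\<open>'l\<close>) covers all ordered value groups: the image
  of a valuation is isomorphic to a group of cosets in the field's multiplicative group.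
\<close>

lemma field_valuation_universe:
  fixes F :: "('l, 'k) ring_scheme" and G :: "('g, 'n) monoid_scheme"
  assumes "field_valuation F G r v"
  obtains G' :: "'l set monoid" and r' v' where
    "field_valuation F G' r' v'"
    "\<And>q x y. \<lbrakk>x \<in> carrier F; y \<in> carrier F\<rbrakk>
        \<Longrightarrow> rat_mul_le G' r' q (v' x) (v' y) \<longleftrightarrow> rat_mul_le G r q (v x) (v y)"
    "\<And>A. A \<subseteq> carrier F \<Longrightarrow> nonneg_on G' r' v' A \<longleftrightarrow> nonneg_on G r v A"
proof -
  interpret field_valuation F G r v by (rule assms)
  define H where "H = {g. \<exists>x\<in>carrier F. v x = Some g}"
  define fib where "fib g = {x \<in> carrier F. v x = Some g}" for g
  define d where "d = inv_into H fib"
  have inj: "inj_on fib H"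
  proof (rule inj_onI)
    fix g h assume "g \<in> H" "fib g = fib h"
    moreover from this obtain x where "x \<in> fib g" "v x = Some g" by (auto simp: H_def fib_def)
    ultimately have "v x = Some g" "v x = Some h" by (auto simp: fib_def)
    then show "g = h" by simp
  qed
  have d[simp]: "d (fib g) = g" if "g \<in> H" for g
    using inv_into_f_f[OF inj that] by (simp add: d_def)
  have fib_eq: "fib g = fib h \<longleftrightarrow> g = h" if "g \<in> H" "h \<in> H" for g h
    using inj that by (auto dest: inj_onD)
  have v_cases: "v x = None \<and> x = \<zero>\<^bsub>F\<^esub> \<or> (\<exists>g\<in>carrier G. v x = Some g)" if "x \<in> carrier F" for x
    using v_zero v_nonzero[of x] that by auto
  have H_sub: "g \<in> carrier G" if "g \<in> H" for g
    using that v_cases by (fastforce simp: H_def)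
  have H_mult: "g \<otimes>\<^bsub>G\<^esub> h \<in> H" if gh: "g \<in> H" "h \<in> H" for g h
  proof -
    from gh obtain x y where "x \<in> carrier F" "v x = Some g" "y \<in> carrier F" "v y = Some h"
      by (auto simp: H_def)
    then have "v (x \<otimes>\<^bsub>F\<^esub> y) = Some (g \<otimes>\<^bsub>G\<^esub> h)" "x \<otimes>\<^bsub>F\<^esub> y \<in> carrier F"
      by (auto simp: v_mult ext_add_def)
    then show ?thesis by (auto simp: H_def)
  qed
  have v_one: "v \<one>\<^bsub>F\<^esub> = Some \<one>\<^bsub>G\<^esub>"
  proof -
    obtain g where g: "g \<in> carrier G" "v \<one>\<^bsub>F\<^esub> = Some g"
      using v_nonzero[of "\<one>\<^bsub>F\<^esub>"] by auto
    have "v (\<one>\<^bsub>F\<^esub> \<otimes>\<^bsub>F\<^esub> \<one>\<^bsub>F\<^esub>) = Some (g \<otimes>\<^bsub>G\<^esub> g)"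
      unfolding v_mult[OF F.one_closed F.one_closed] by (simp add: g ext_add_def)
    with g show ?thesis by simp
  qed
  have H_one: "\<one>\<^bsub>G\<^esub> \<in> H"
    using v_one by (auto simp: H_def)
  have H_inv: "\<exists>h\<in>H. h \<otimes>\<^bsub>G\<^esub> g = \<one>\<^bsub>G\<^esub>" if g: "g \<in> H" for g
  proof -
    obtain x where x: "x \<in> carrier F" "v x = Some g" using g by (auto simp: H_def)
    then have "x \<in> Units F" using v_zero by (auto simp: F.field_Units)
    then have i: "inv\<^bsub>F\<^esub> x \<in> carrier F" "inv\<^bsub>F\<^esub> x \<otimes>\<^bsub>F\<^esub> x = \<one>\<^bsub>F\<^esub>" by simp_all
    then have "ext_add G (v (inv\<^bsub>F\<^esub> x)) (v x) = Some \<one>\<^bsub>G\<^esub>"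
      using v_mult[of "inv\<^bsub>F\<^esub> x" x] x v_one by simp
    then obtain h where "v (inv\<^bsub>F\<^esub> x) = Some h" "h \<otimes>\<^bsub>G\<^esub> g = \<one>\<^bsub>G\<^esub>"
      using x by (auto simp: ext_add_def split: option.splits)
    with i show ?thesis by (auto simp: H_def)
  qed
  define G' :: "'l set monoid" where
    "G' = \<lparr>carrier = fib ` H, monoid.mult = (\<lambda>U W. fib (d U \<otimes>\<^bsub>G\<^esub> d W)), one = fib \<one>\<^bsub>G\<^esub>\<rparr>"
  define r' where "r' = {(fib g, fib h) | g h. g \<in> H \<and> h \<in> H \<and> (g, h) \<in> r}"
  define v' where "v' x = map_option fib (v x)" for x
  have r'_iff: "(fib g, fib h) \<in> r' \<longleftrightarrow> (g, h) \<in> r" if "g \<in> H" "h \<in> H" for g h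
    using that fib_eq by (auto simp: r'_def)
  have G'_simps: "carrier G' = fib ` H" "\<one>\<^bsub>G'\<^esub> = fib \<one>\<^bsub>G\<^esub>"
      "\<And>g h. \<lbrakk>g \<in> H; h \<in> H\<rbrakk> \<Longrightarrow> fib g \<otimes>\<^bsub>G'\<^esub> fib h = fib (g \<otimes>\<^bsub>G\<^esub> h)"
    by (simp_all add: G'_def)
  have comm: "comm_group G'"
  proof (rule comm_groupI)
    fix U assume "U \<in> carrier G'"
    then obtain g where g: "g \<in> H" "U = fib g" by (auto simp: G'_simps)
    from H_inv[OF g(1)] obtain h where "h \<in> H" "h \<otimes>\<^bsub>G\<^esub> g = \<one>\<^bsub>G\<^esub>" by blast
    with g show "\<exists>W\<in>carrier G'. W \<otimes>\<^bsub>G'\<^esub> U = \<one>\<^bsub>G'\<^esub>"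
      by (auto simp: G'_simps intro!: bexI[of _ h])
  next
    fix U W assume "U \<in> carrier G'" "W \<in> carrier G'"
    then obtain g h where "g \<in> H" "U = fib g" "h \<in> H" "W = fib h" by (auto simp: G'_simps)
    then show "U \<otimes>\<^bsub>G'\<^esub> W = W \<otimes>\<^bsub>G'\<^esub> U"
      by (simp add: G'_simps H_sub G.m_comm)
  next
    fix T U W assume "T \<in> carrier G'" "U \<in> carrier G'" "W \<in> carrier G'"
    then obtain f g h where "f \<in> H" "T = fib f" "g \<in> H" "U = fib g" "h \<in> H" "W = fib h"
      by (auto simp: G'_simps)
    then show "(T \<otimes>\<^bsub>G'\<^esub> U) \<otimes>\<^bsub>G'\<^esub> W = T \<otimes>\<^bsub>G'\<^esub> (U \<otimes>\<^bsub>G'\<^esub> W)"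
      by (simp add: G'_simps H_mult H_sub G.m_assoc)
  qed (auto simp: G'_simps H_mult H_one H_sub)
  have lin: "linear_order_on (carrier G) r" by (rule G.linear_order)
  have rD: "(g, g) \<in> r" if "g \<in> carrier G" for g
    using lin that by (auto simp: order_on_defs refl_on_def)
  have r_trans: "(g, k) \<in> r" if "(g, h) \<in> r" "(h, k) \<in> r" for g h k
    using lin that by (auto simp: order_on_defs dest: transD)
  have r_antisym: "g = h" if "(g, h) \<in> r" "(h, g) \<in> r" for g h
    using lin that by (auto simp: order_on_defs dest: antisymD)
  have r_total: "(g, h) \<in> r \<or> (h, g) \<in> r" if "g \<in> carrier G" "h \<in> carrier G" for g h
    using lin that rD by (cases "g = h") (auto simp: order_on_defs total_on_def)
  have lin': "linear_order_on (carrier G') r'"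
    unfolding order_on_defs
  proof (intro conjI)
    show "refl_on (carrier G') r'"
      by (auto simp: refl_on_def G'_simps r'_iff rD H_sub)
    show "trans r'"
    proof (rule transI)
      fix T U W assume "(T, U) \<in> r'" "(U, W) \<in> r'"
      then obtain g h h' k where *: "g \<in> H" "h \<in> H" "h' \<in> H" "k \<in> H"
          "T = fib g" "U = fib h" "U = fib h'" "W = fib k" "(g, h) \<in> r" "(h', k) \<in> r"
        unfolding r'_def by blast
      then have "h = h'" using fib_eq by simp
      with * r_trans have "(g, k) \<in> r" by blast
      with * show "(T, W) \<in> r'" by (auto simp: r'_def)
    qed
    show "antisym r'"
      by (rule antisymI) (auto simp: r'_def fib_eq dest: r_antisym)
    show "r' \<subseteq> carrier G' \<times> carrier G'" by (auto simp: r'_def G'_simps)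
    show "total_on (carrier G') r'"
      by (auto simp: total_on_def G'_simps r'_iff dest: r_total[OF H_sub H_sub])
  qed
  have v_H: "v x = None \<or> (\<exists>g\<in>H. v x = Some g)" if "x \<in> carrier F" for x
    using v_cases[OF that] that by (auto simp: H_def)
  define inH where "inH a \<longleftrightarrow> a = None \<or> (\<exists>g\<in>H. a = Some g)" for a
  have ext_le': "ext_le r' (map_option fib a) (map_option fib b) \<longleftrightarrow> ext_le r a b"
    if "inH a" "inH b" for a b
    using that by (auto simp: inH_def ext_le_def r'_iff)
  have ext_add': "ext_add G' (map_option fib a) (map_option fib b) = map_option fib (ext_add G a b)"
      "inH (ext_add G a b)"
    if "inH a" "inH b" for a b
    using that by (auto simp: inH_def ext_add_def G'_simps H_mult)
  have nmul: "ext_nmul G' n (map_option fib a) = map_option fib (ext_nmul G n a) \<and> inH (ext_nmul G n a)"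
    if "inH a" for n a
  proof (induction n)
    case 0
    then show ?case using H_one by (simp add: G'_simps inH_def)
  next
    case (Suc n)
    then show ?case using ext_add' that by simp
  qed
  have inH_v: "inH (v x)" if "x \<in> carrier F" for x
    using v_H[OF that] by (simp add: inH_def)
  have val: "field_valuation F G' r' v'"
  proof (intro field_valuation.intro ordered_comm_group.intro field_valuation_axioms.intro
      ordered_comm_group_axioms.intro)
    show "field F" by (rule F.field_axioms)
    show "comm_group G'" by (rule comm)
    show "linear_order_on (carrier G') r'" by (rule lin')
    fix U W Z assume "(U, W) \<in> r'" "Z \<in> carrier G'"
    then obtain g h k where *: "U = fib g" "W = fib h" "Z = fib k" "g \<in> H" "h \<in> H" "k \<in> H"
        "(g, h) \<in> r"
      by (auto simp: r'_def G'_simps)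
    then have "(g \<otimes>\<^bsub>G\<^esub> k, h \<otimes>\<^bsub>G\<^esub> k) \<in> r" by (simp add: G.mult_mono H_sub)
    with * show "(U \<otimes>\<^bsub>G'\<^esub> Z, W \<otimes>\<^bsub>G'\<^esub> Z) \<in> r'"
      by (simp add: G'_simps r'_iff H_mult)
  next
    show "v' \<zero>\<^bsub>F\<^esub> = None" by (simp add: v'_def v_zero)
  next
    fix x assume x: "x \<in> carrier F - {\<zero>\<^bsub>F\<^esub>}"
    then have "v x \<noteq> None" using v_nonzero[OF x] by auto
    then show "v' x \<in> Some ` carrier G'"
      using v_H[of x] x by (auto simp: v'_def G'_simps)
  next
    fix x y assume xy: "x \<in> carrier F" "y \<in> carrier F"
    show "v' (x \<otimes>\<^bsub>F\<^esub> y) = ext_add G' (v' x) (v' y)"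
      using xy by (simp add: v'_def v_mult ext_add' inH_v)
    show "ext_le r' (v' x) (v' (x \<oplus>\<^bsub>F\<^esub> y)) \<or> ext_le r' (v' y) (v' (x \<oplus>\<^bsub>F\<^esub> y))"
      using xy v_add by (simp add: v'_def ext_le' inH_v)
  qed
  show thesis
  proof (rule that[OF val])
    fix q x y assume "x \<in> carrier F" "y \<in> carrier F"
    then show "rat_mul_le G' r' q (v' x) (v' y) \<longleftrightarrow> rat_mul_le G r q (v x) (v y)"
      by (simp add: rat_mul_le_def v'_def nmul inH_v ext_le')
  next
    fix A assume A: "A \<subseteq> carrier F"
    have "ext_le r' (Some \<one>\<^bsub>G'\<^esub>) (v' x) \<longleftrightarrow> ext_le r (Some \<one>\<^bsub>G\<^esub>) (v x)" if "x \<in> A" for x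
      using ext_le'[of "Some \<one>\<^bsub>G\<^esub>" "v x"] inH_v[of x] that A H_one
      by (auto simp: v'_def G'_simps inH_def)
    then show "nonneg_on G' r' v' A \<longleftrightarrow> nonneg_on G r v A"
      by (simp add: nonneg_on_def)
  qed
qed


section \<open>Integral closure and fractional powers of ideals\<close>

text \<open>
  \<open>L\<close> is an algebraic closure of the fraction field of the domain \<open>R\<close>, embedded via \<open>\<iota>\<close>; the
  subfield generated by the image of \<open>R\<close> is the fraction field.
\<close>

definition alg_closure_of_fractions ::
    "('a, 'm) ring_scheme \<Rightarrow> ('l, 'k) ring_scheme \<Rightarrow> ('a \<Rightarrow> 'l) \<Rightarrow> bool" where
  "alg_closure_of_fractions R L \<iota> \<longleftrightarrow>
     \<iota> \<in> ring_hom R L \<and> inj_on \<iota> (carrier R) \<and>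
     algebraic_closure L (generate_field L (\<iota> ` carrier R))"

definition integral_over :: "('l, 'k) ring_scheme \<Rightarrow> 'l set \<Rightarrow> 'l \<Rightarrow> bool" where
  "integral_over L A x \<longleftrightarrow>
     (\<exists>f \<in> carrier (A[X]\<^bsub>L\<^esub>). f \<noteq> [] \<and> lead_coeff f = \<one>\<^bsub>L\<^esub> \<and> ring.eval L f x = \<zero>\<^bsub>L\<^esub>)"

definition abs_int_closure ::
    "('a, 'm) ring_scheme \<Rightarrow> ('l, 'k) ring_scheme \<Rightarrow> ('a \<Rightarrow> 'l) \<Rightarrow> ('l, 'k) ring_scheme" where
  "abs_int_closure R L \<iota> = L\<lparr>carrier := {x \<in> carrier L. integral_over L (\<iota> ` carrier R) x}\<rparr>"

text \<open>
  \<open>S\<close> is a subring of the field \<open>L\<close> with fraction field \<open>L\<close>, as is the case for the absolute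
  integral closure, and \<open>I\<close> is an ideal of \<open>S\<close>.
\<close>

definition frac_power ::
    "('l, 'k) ring_scheme \<Rightarrow> ('l, 'k) ring_scheme \<Rightarrow> 'l set \<Rightarrow> rat \<Rightarrow> 'l set" where
  "frac_power L S I q =
     {x \<in> carrier S. \<forall>(G :: 'l set monoid) r v.
        field_valuation L G r v \<and> nonneg_on G r v (carrier S) \<longrightarrow>
        (\<exists>y\<in>I. rat_mul_le G r q (v y) (v x))}"

definition frac_power_gt ::
    "('l, 'k) ring_scheme \<Rightarrow> ('l, 'k) ring_scheme \<Rightarrow> 'l set \<Rightarrow> real \<Rightarrow> 'l set" where
  "frac_power_gt L S I t = (\<Union>q \<in> {q. t < real_of_rat q}. frac_power L S I q)"

lemma frac_power_all_valuations:
  fixes G :: "('g, 'n) monoid_scheme"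
  assumes "x \<in> frac_power L S I q" "carrier S \<subseteq> carrier L" "I \<subseteq> carrier S"
    and "field_valuation L G r v" "nonneg_on G r v (carrier S)"
  shows "\<exists>y\<in>I. rat_mul_le G r q (v y) (v x)"
proof (rule field_valuation_universe[OF assms(4)])
  fix G' :: "'a set monoid" and r' v'
  assume *: "field_valuation L G' r' v'"
    "\<And>q x y. \<lbrakk>x \<in> carrier L; y \<in> carrier L\<rbrakk>
        \<Longrightarrow> rat_mul_le G' r' q (v' x) (v' y) \<longleftrightarrow> rat_mul_le G r q (v x) (v y)"
    "\<And>A. A \<subseteq> carrier L \<Longrightarrow> nonneg_on G' r' v' A \<longleftrightarrow> nonneg_on G r v A"
  have x: "x \<in> carrier L"
    using assms(1,2) by (auto simp: frac_power_def)
  have "nonneg_on G' r' v' (carrier S)"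
    using *(3) assms(2,5) by blast
  then obtain y where "y \<in> I" "rat_mul_le G' r' q (v' y) (v' x)"
    using assms(1) *(1) unfolding frac_power_def by blast
  then show ?thesis
    using *(2) x assms(2,3) by blast
qed


section \<open>Local algebra\<close>

definition radical :: "('a, 'm) ring_scheme \<Rightarrow> 'a set \<Rightarrow> 'a set" where
  "radical R I = {x \<in> carrier R. \<exists>n::nat. x [^]\<^bsub>R\<^esub> n \<in> I}"

definition ideal_power :: "('a, 'm) ring_scheme \<Rightarrow> 'a set \<Rightarrow> nat \<Rightarrow> 'a set" where
  "ideal_power R I n = I [^]\<^bsub>ideals_set R\<^esub> n"

definition local_ring :: "('a, 'm) ring_scheme \<Rightarrow> 'a set \<Rightarrow> bool" where
  "local_ring R \<mm> \<longleftrightarrow> maximalideal \<mm> R \<and> (\<forall>\<nn>. maximalideal \<nn> R \<longrightarrow> \<nn> = \<mm>)"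

text \<open>
  Completeness says that the canonical map to the inverse limit of the quotients by the powers
  of \<open>\<mm>\<close> is bijective. An element of the limit is given by a sequence of representatives.
\<close>

definition adically_complete :: "('a, 'm) ring_scheme \<Rightarrow> 'a set \<Rightarrow> bool" where
  "adically_complete R \<mm> \<longleftrightarrow>
     (\<forall>s :: nat \<Rightarrow> 'a.
        (\<forall>n. s n \<in> carrier R) \<and> (\<forall>n. s (Suc n) \<ominus>\<^bsub>R\<^esub> s n \<in> ideal_power R \<mm> n) \<longrightarrow>
        (\<exists>!x. x \<in> carrier R \<and> (\<forall>n. x \<ominus>\<^bsub>R\<^esub> s n \<in> ideal_power R \<mm> n)))"

definition krull_dim :: "('a, 'm) ring_scheme \<Rightarrow> enat" where
  "krull_dim R =
     Sup {enat n | n. \<exists>P :: nat \<Rightarrow> 'a set. (\<forall>i\<le>n. primeideal (P i) R) \<and> (\<forall>i<n. P i \<subset> P (Suc i))}"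

definition system_of_parameters :: "('a, 'm) ring_scheme \<Rightarrow> 'a set \<Rightarrow> 'a list \<Rightarrow> bool" where
  "system_of_parameters R \<mm> xs \<longleftrightarrow>
     set xs \<subseteq> \<mm> \<and> enat (length xs) = krull_dim R \<and> radical R (Idl\<^bsub>R\<^esub> (set xs)) = \<mm>"

definition regular_sequence :: "('b, 'n) ring_scheme \<Rightarrow> 'b list \<Rightarrow> bool" where
  "regular_sequence B xs \<longleftrightarrow>
     (\<forall>i < length xs. \<forall>b \<in> carrier B.
        xs ! i \<otimes>\<^bsub>B\<^esub> b \<in> Idl\<^bsub>B\<^esub> (set (take i xs)) \<longrightarrow> b \<in> Idl\<^bsub>B\<^esub> (set (take i xs))) \<and>
     Idl\<^bsub>B\<^esub> (set xs) \<noteq> carrier B"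

definition bcm_algebra ::
    "('a, 'm) ring_scheme \<Rightarrow> 'a set \<Rightarrow> ('b, 'n) ring_scheme \<Rightarrow> ('a \<Rightarrow> 'b) \<Rightarrow> bool" where
  "bcm_algebra R \<mm> B \<psi> \<longleftrightarrow>
     cring B \<and> \<psi> \<in> ring_hom R B \<and>
     (\<forall>xs. system_of_parameters R \<mm> xs \<longrightarrow> regular_sequence B (map \<psi> xs))"


section \<open>Characteristic p notions\<close>

definition F_finite :: "('a, 'm) ring_scheme \<Rightarrow> nat \<Rightarrow> bool" where
  "F_finite R p \<longleftrightarrow>
     (\<exists>U \<subseteq> carrier R. finite U \<and>
        (\<forall>y \<in> carrier R. \<exists>c \<in> U \<rightarrow> carrier R. y = (\<Oplus>\<^bsub>R\<^esub>u\<in>U. c u [^]\<^bsub>R\<^esub> p \<otimes>\<^bsub>R\<^esub> u)))"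

text \<open>For \<open>q = p ^ e\<close> this is the Frobenius power of \<open>I\<close>.\<close>

definition frob_power :: "('a, 'm) ring_scheme \<Rightarrow> 'a set \<Rightarrow> nat \<Rightarrow> 'a set" where
  "frob_power R I q = Idl\<^bsub>R\<^esub> ((\<lambda>x. x [^]\<^bsub>R\<^esub> q) ` I)"

text \<open>
  Tight closure in a domain: the multiplier only has to avoid the unique minimal prime, that is,
  it has to be nonzero.
\<close>

definition tight_closure :: "('a, 'm) ring_scheme \<Rightarrow> nat \<Rightarrow> 'a set \<Rightarrow> 'a set" where
  "tight_closure R p I =
     {x \<in> carrier R. \<exists>c \<in> carrier R - {\<zero>\<^bsub>R\<^esub>}.
        \<forall>\<^sub>F e in sequentially. c \<otimes>\<^bsub>R\<^esub> x [^]\<^bsub>R\<^esub> (p ^ e) \<in> frob_power R I (p ^ e)}"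

definition weakly_F_regular :: "('a, 'm) ring_scheme \<Rightarrow> nat \<Rightarrow> bool" where
  "weakly_F_regular R p \<longleftrightarrow> (\<forall>I. ideal I R \<longrightarrow> tight_closure R p I = I)"

definition captures_tight_closure ::
    "('a, 'm) ring_scheme \<Rightarrow> nat \<Rightarrow> ('b, 'n) ring_scheme \<Rightarrow> ('a \<Rightarrow> 'b) \<Rightarrow> bool" where
  "captures_tight_closure R p B \<psi> \<longleftrightarrow>
     (\<forall>I. ideal I R \<longrightarrow> {x \<in> carrier R. \<psi> x \<in> Idl\<^bsub>B\<^esub> (\<psi> ` I)} = tight_closure R p I)"

text \<open>
  \<^const>\<open>Sup\<close> on the naturals is the maximum of a finite nonempty set and 0 for the empty set.
  Under the assumption that \<open>\<aa>\<close> lies in the radical of \<open>J\<close> the set below is finite, and it is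
  nonempty for large \<open>q = p ^ e\<close> if \<open>\<aa>\<close> is nonzero and \<open>J\<close> is proper.
\<close>

definition F_nu :: "('a, 'm) ring_scheme \<Rightarrow> 'a set \<Rightarrow> 'a set \<Rightarrow> nat \<Rightarrow> nat" where
  "F_nu R J \<aa> q = Sup {n. 0 < n \<and> \<not> ideal_power R \<aa> n \<subseteq> frob_power R J q}"

definition F_threshold :: "('a, 'm) ring_scheme \<Rightarrow> nat \<Rightarrow> 'a set \<Rightarrow> 'a set \<Rightarrow> real" where
  "F_threshold R p J \<aa> = lim (\<lambda>e. real (F_nu R J \<aa> (p ^ e)) / real (p ^ e))"

text \<open>
  The supremum is taken in the extended nonnegative reals, so that it is 0 for the empty set and
  infinite for an unbounded one.
\<close>

definition bcm_threshold ::
    "('l, 'k) ring_scheme \<Rightarrow> ('l, 'k) ring_scheme \<Rightarrow> ('a \<Rightarrow> 'l) \<Rightarrow>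
     ('b, 'n) ring_scheme \<Rightarrow> ('l \<Rightarrow> 'b) \<Rightarrow> 'a set \<Rightarrow> 'a set \<Rightarrow> ennreal" where
  "bcm_threshold L S \<iota> B \<phi> J \<aa> =
     Sup {ennreal t | t. 0 \<le> t \<and>
            \<not> \<phi> ` frac_power_gt L S (Idl\<^bsub>S\<^esub> (\<iota> ` \<aa>)) t \<subseteq> Idl\<^bsub>B\<^esub> ((\<phi> \<circ> \<iota>) ` J)}"

lemma frac_power_gt_antimono: "t \<le> u \<Longrightarrow> frac_power_gt L S I u \<subseteq> frac_power_gt L S I t"
  unfolding frac_power_gt_def by (intro UN_mono) auto

lemma bcm_threshold_eq_Inf:
  "bcm_threshold L S \<iota> B \<phi> J \<aa> =
     Inf {ennreal t | t. 0 \<le> t \<and>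
            \<phi> ` frac_power_gt L S (Idl\<^bsub>S\<^esub> (\<iota> ` \<aa>)) t \<subseteq> Idl\<^bsub>B\<^esub> ((\<phi> \<circ> \<iota>) ` J)}"
proof -
  define P where "P t \<longleftrightarrow>
    \<phi> ` frac_power_gt L S (Idl\<^bsub>S\<^esub> (\<iota> ` \<aa>)) t \<subseteq> Idl\<^bsub>B\<^esub> ((\<phi> \<circ> \<iota>) ` J)" for t
  have mono: "P u" if "P t" "t \<le> u" for t u
    using that(1) image_mono[OF frac_power_gt_antimono[OF that(2)]] subset_trans
    unfolding P_def by metis
  let ?A = "{ennreal t | t. 0 \<le> t \<and> \<not> P t}" and ?B = "{ennreal t | t. 0 \<le> t \<and> P t}"
  have "Sup ?A = Inf ?B"
  proof (rule antisym)
    show "Sup ?A \<le> Inf ?B"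
    proof (intro Sup_least Inf_greatest)
      fix a b assume "a \<in> ?A" "b \<in> ?B"
      then obtain t u where tu: "a = ennreal t" "\<not> P t" "b = ennreal u" "P u" by auto
      then have "\<not> u \<le> t" using mono by metis
      then show "a \<le> b" using tu by (simp add: ennreal_leI)
    qed
    show "Inf ?B \<le> Sup ?A"
    proof (rule ccontr)
      assume "\<not> Inf ?B \<le> Sup ?A"
      then obtain c where c: "Sup ?A < c" "c < Inf ?B"
        by (meson dense not_le)
      then obtain t where t: "0 \<le> t" "c = ennreal t"
        by (cases c) auto
      show False
      proof (cases "P t")
        case True
        then have "Inf ?B \<le> c" using t by (intro Inf_lower) auto
        then show False using c by simp
      next
        case False
        then have "c \<le> Sup ?A" using t by (intro Sup_upper) auto
        then show False using c by simp
      qed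
    qed
  qed
  then show ?thesis by (simp add: bcm_threshold_def P_def)
qed

end

theory Submission
  imports Defs
begin

text \<open>
  Let \<open>S\<close> be the absolute integral closure of \<open>R\<close>, and write \<open>q\<close> for the powers \<open>p\<^sup>e\<close> and \<open>J\<^bsup>[q]\<^esup>\<close> for
  the Frobenius powers. Two estimates give the theorem.
  
  For the first, suppose that \<open>\<aa>\<^sup>n \<subseteq> J\<^bsup>[q]\<^esup>\<close> for all \<open>n \<ge> t q\<close>, where \<open>q\<close> may be chosen arbitrarily large.
  Then \<open>(\<aa>S)\<^bsub>>t\<^esub> \<subseteq> J S\<close>, whose image lies in \<open>J B\<close>, so the BCM-threshold is at most \<open>t\<close>. Indeed, let
  \<open>x\<close> lie in the fractional power with exponent \<open>a / b > t\<close>. By the valuative criterion \<open>x\<^sup>b\<close> is integral over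
  \<open>\<aa>\<^sup>a S\<close>. An integral equation of degree \<open>N\<close> for \<open>x\<^sup>b\<close> implies that the power with exponent \<open>b k\<close> of \<open>x\<close> lies
  in \<open>\<aa>\<^sup>n S\<close> with \<open>n = a (k - N)\<close>, for every \<open>k\<close>. As \<open>N\<close> is fixed, the choice \<open>k = q div b\<close> for large \<open>q\<close>
  yields \<open>n \<ge> t q\<close>, and the \<open>q\<close>-th power of \<open>x\<close> lies in \<open>J\<^bsup>[q]\<^esup> S\<close>. Since \<open>S\<close> is perfect, \<open>q\<close>-th roots
  can be taken, and \<open>x \<in> J S\<close> (\<open>frac_power_gt_subset\<close>). The valuative criterion rests on Chevalley's theorem
  that a proper ideal of a subring of a field consists of non-units of some valuation ring; the same theorem
  describes the integral closure \<open>S\<close> as an intersection of valuation rings, whence \<open>S\<close> is a ring that is closed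
  under roots.
  
  For the second, suppose that \<open>\<aa>\<^sup>n\<close> contains an element \<open>x\<close> outside \<open>J\<^bsup>[q]\<^esup>\<close>. Its \<open>q\<close>-th root \<open>s\<close> in
  \<open>S\<close> lies in the fractional power with exponent \<open>n / q\<close> (\<open>root_in_frac_power\<close>). If the image of \<open>s\<close> were in
  \<open>J B\<close>, then Frobenius on \<open>B\<close> would place the image of \<open>x\<close> in \<open>J\<^bsup>[q]\<^esup> B\<close>. As \<open>B\<close> captures tight closure,
  \<open>x\<close> would lie in the tight closure of \<open>J\<^bsup>[q]\<^esup>\<close>, which is \<open>J\<^bsup>[q]\<^esup>\<close> because \<open>R\<close> is weakly \<open>F\<close>-regular.
  So the BCM-threshold \<open>\<tau>\<close> is at least \<open>n / q\<close>.
  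
  A pigeonhole argument shows that the largest exponent \<open>\<nu>\<close> with \<open>\<aa>\<^sup>\<nu>\<close> not contained in \<open>J\<^bsup>[q]\<^esup>\<close> is at most
  linear in \<open>q\<close>, so that \<open>\<tau>\<close> is finite. By the second estimate \<open>\<nu> / q \<le> \<tau>\<close> for all \<open>q\<close>; by the first
  estimate no \<open>b < \<tau>\<close> can satisfy \<open>\<nu> / q \<le> b\<close> for arbitrarily large \<open>q\<close>. Hence the ratios converge to \<open>\<tau>\<close>,
  which is the theorem; the existence of the limit is part of the conclusion.
\<close>

section \<open>Spans graded by the powers of an element\<close>

context ring begin

text \<open>
  The elements \<open>w\<^sub>0 + w\<^sub>1 z + \<dots> + w\<^sub>N z\<^sup>N\<close> with \<open>w\<^sub>i \<in> W i\<close>. A constant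
  family \<open>W\<close> gives the polynomials in \<open>z\<close> of degree at most \<open>N\<close> with coefficients in a set; a filtration
  by ideals gives the pieces of a Rees algebra. Only the membership of sums and products matters below, so
  the coefficients are not recorded.
\<close>

inductive_set graded_span :: "(nat \<Rightarrow> 'a set) \<Rightarrow> 'a \<Rightarrow> nat \<Rightarrow> 'a set"
  for W :: "nat \<Rightarrow> 'a set" and z :: 'a and N :: nat where
  zero: "\<zero> \<in> graded_span W z N"
| step: "\<lbrakk>i \<le> N; a \<in> W i; w \<in> graded_span W z N\<rbrakk> \<Longrightarrow> a \<otimes> z [^] i \<oplus> w \<in> graded_span W z N"

lemma graded_span_carrier:
  assumes "\<forall>i. W i \<subseteq> carrier R" "z \<in> carrier R" "w \<in> graded_span W z N"
  shows "w \<in> carrier R"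
  using assms(3) by induction (use assms(1,2) in auto)

lemma graded_span_mono:
  assumes "w \<in> graded_span W z N" "N \<le> M" "\<forall>i. W i \<subseteq> W' i"
  shows "w \<in> graded_span W' z M"
  using assms(1)
proof induction
  case zero
  then show ?case by (rule graded_span.zero)
next
  case (step i a w)
  then show ?case using assms(2,3) by (intro graded_span.step) auto
qed

lemma graded_span_single:
  assumes "i \<le> N" "a \<in> W i" "W i \<subseteq> carrier R" "z \<in> carrier R"
  shows "a \<otimes> z [^] i \<in> graded_span W z N"
  using graded_span.step[where z = z and N = N and W = W, OF assms(1,2) graded_span.zero] assms by auto

lemma graded_span_add:
  assumes "\<forall>i. W i \<subseteq> carrier R" "z \<in> carrier R"
    and "v \<in> graded_span W z N" "w \<in> graded_span W z N"
  shows "v \<oplus> w \<in> graded_span W z N"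
  using assms(3)
proof induction
  case zero
  then show ?case using assms(4) graded_span_carrier[OF assms(1,2,4)] by simp
next
  case (step i a v)
  then have "a \<otimes> z [^] i \<oplus> v \<oplus> w = a \<otimes> z [^] i \<oplus> (v \<oplus> w)"
    using graded_span_carrier[OF assms(1,2)] assms(1,2,4) by (simp add: a_assoc subset_iff)
  then show ?case using step by (simp add: graded_span.step)
qed

lemma graded_span_minus:
  assumes "\<forall>i. W i \<subseteq> carrier R" "z \<in> carrier R"
    and "\<forall>i. \<forall>a\<in>W i. \<ominus> a \<in> W i"
    and "w \<in> graded_span W z N"
  shows "\<ominus> w \<in> graded_span W z N"
  using assms(4)
proof induction
  case zero
  then show ?case by (simp add: graded_span.zero)
next
  case (step i a w)
  have "\<ominus> (a \<otimes> z [^] i \<oplus> w) = (\<ominus> a) \<otimes> z [^] i \<oplus> \<ominus> w"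
    using step(2) graded_span_carrier[OF assms(1,2) step(3)] assms(1,2)
    by (auto simp: minus_add l_minus subset_iff)
  then show ?case using step assms(3) by (simp add: graded_span.step)
qed

end

lemma (in cring) graded_span_mult:
  assumes "\<forall>i. W1 i \<subseteq> carrier R" "\<forall>i. W2 i \<subseteq> carrier R" "\<forall>i. W i \<subseteq> carrier R" "z \<in> carrier R"
    and "\<forall>i j. \<forall>a\<in>W1 i. \<forall>b\<in>W2 j. a \<otimes> b \<in> W (i + j)"
    and "v \<in> graded_span W1 z N" "w \<in> graded_span W2 z M"
  shows "v \<otimes> w \<in> graded_span W z (N + M)"
  using assms(6)
proof induction
  case zero
  then show ?case using graded_span_carrier[OF assms(2,4,7)] by (simp add: graded_span.zero)
next
  case (step i a v)
  have a: "a \<in> carrier R" using step assms by blast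
  have "a \<otimes> z [^] i \<otimes> w \<in> graded_span W z (N + M)"
    using assms(7)
  proof induction
    case zero
    then show ?case using a assms(4) by (simp add: graded_span.zero)
  next
    case (step j b w)
    have b: "b \<in> carrier R" "w \<in> carrier R"
      using step(2) assms(2) graded_span_carrier[OF assms(2,4) step(3)] by blast+
    have "a \<otimes> z [^] i \<otimes> (b \<otimes> z [^] j \<oplus> w) = (a \<otimes> b) \<otimes> z [^] (i + j) \<oplus> a \<otimes> z [^] i \<otimes> w"
      using a b assms(4) by (simp add: r_distr m_ac nat_pow_mult[symmetric])
    then show ?case
      using step \<open>i \<le> N\<close> \<open>a \<in> W1 i\<close> assms(5) by (simp add: graded_span.step)
  qed
  moreover have "(a \<otimes> z [^] i \<oplus> v) \<otimes> w = a \<otimes> z [^] i \<otimes> w \<oplus> v \<otimes> w"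
    using a step graded_span_carrier[OF assms(1,4)] graded_span_carrier[OF assms(2,4,7)] assms(4)
    by (simp add: l_distr)
  ultimately show ?case
    using graded_span_add[OF assms(3,4)] step by simp
qed

lemma (in cring) graded_span_subring:
  assumes "\<forall>i. W i \<subseteq> carrier R" "z \<in> carrier R" "\<one> \<in> W 0"
    and "\<forall>i. \<forall>a\<in>W i. \<ominus> a \<in> W i"
    and "\<forall>i j. \<forall>a\<in>W i. \<forall>b\<in>W j. a \<otimes> b \<in> W (i + j)"
  shows "subring (\<Union>N. graded_span W z N) R"
proof (rule subringI)
  show "(\<Union>N. graded_span W z N) \<subseteq> carrier R"
    using graded_span_carrier[OF assms(1,2)] by blast
  show "\<one> \<in> (\<Union>N. graded_span W z N)"
    using graded_span_single[of 0 0 \<one> W z] assms by auto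
next
  fix h assume "h \<in> (\<Union>N. graded_span W z N)"
  then show "\<ominus> h \<in> (\<Union>N. graded_span W z N)"
    using graded_span_minus[OF assms(1,2,4)] by blast
next
  fix v w assume "v \<in> (\<Union>N. graded_span W z N)" "w \<in> (\<Union>N. graded_span W z N)"
  then obtain N M where *: "v \<in> graded_span W z N" "w \<in> graded_span W z M" by blast
  then show "v \<otimes> w \<in> (\<Union>N. graded_span W z N)"
    using graded_span_mult[OF assms(1,1,1,2,5)] by blast
  have "v \<in> graded_span W z (max N M)" "w \<in> graded_span W z (max N M)"
    using * graded_span_mono by (meson max.cobounded1 max.cobounded2 order_refl)+
  then show "v \<oplus> w \<in> (\<Union>N. graded_span W z N)"
    using graded_span_add[OF assms(1,2)] by blast
qed

section \<open>Chevalley's extension theorem\<close>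

text \<open>
  The pairs of a subring \<open>A\<close> and an ideal of \<open>A\<close> without \<open>1\<close>, among which the proof of Chevalley's
  theorem chooses a maximal one.
\<close>

definition proper_ideal_in :: "('a, 'm) ring_scheme \<Rightarrow> 'a set \<Rightarrow> 'a set \<Rightarrow> bool" where
  "proper_ideal_in R A \<nn> \<longleftrightarrow> subring A R \<and> \<nn> \<subseteq> A \<and> \<zero>\<^bsub>R\<^esub> \<in> \<nn> \<and> (\<forall>x\<in>\<nn>. \<forall>y\<in>\<nn>. x \<oplus>\<^bsub>R\<^esub> y \<in> \<nn>) \<and>
     (\<forall>a\<in>A. \<forall>x\<in>\<nn>. a \<otimes>\<^bsub>R\<^esub> x \<in> \<nn>) \<and> \<one>\<^bsub>R\<^esub> \<notin> \<nn>"

text \<open>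
  In a field, a pair with \<open>x y = 1\<close> is a nonzero element with its inverse. This form avoids the inverse
  operation, which has no meaning at \<open>0\<close>.
\<close>

definition valuation_ring :: "('a, 'm) ring_scheme \<Rightarrow> 'a set \<Rightarrow> bool" where
  "valuation_ring R V \<longleftrightarrow> subring V R \<and> (\<forall>x \<in> carrier R. \<forall>y \<in> carrier R. x \<otimes>\<^bsub>R\<^esub> y = \<one>\<^bsub>R\<^esub> \<longrightarrow> x \<in> V \<or> y \<in> V)"

text \<open>
  Both ways of enlarging a pair that occur below, adjoining an element and passing to a Rees algebra, are
  instances of this lemma.
\<close>

lemma (in cring) graded_span_proper_ideal:
  assumes "\<forall>i. W i \<subseteq> carrier R" "z \<in> carrier R" "\<one> \<in> W 0"
    and "\<forall>i. \<forall>a\<in>W i. \<ominus> a \<in> W i"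
    and "\<forall>i j. \<forall>a\<in>W i. \<forall>b\<in>W j. a \<otimes> b \<in> W (i + j)"
    and "\<forall>i. W' i \<subseteq> W i"
    and "\<forall>i j. \<forall>a\<in>W i. \<forall>b\<in>W' j. a \<otimes> b \<in> W' (i + j)"
    and "\<And>N. \<one> \<notin> graded_span W' z N"
  shows "proper_ideal_in R (\<Union>N. graded_span W z N) (\<Union>N. graded_span W' z N)"
  unfolding proper_ideal_in_def
proof (intro conjI ballI)
  have W': "\<forall>i. W' i \<subseteq> carrier R" using assms(1,6) by blast
  show "subring (\<Union>N. graded_span W z N) R" by (rule graded_span_subring[OF assms(1-5)])
  show "(\<Union>N. graded_span W' z N) \<subseteq> (\<Union>N. graded_span W z N)"
    using graded_span_mono[OF _ order_refl assms(6)] by blast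
  show "\<zero> \<in> (\<Union>N. graded_span W' z N)" by (auto intro: graded_span.zero)
  show "\<one> \<notin> (\<Union>N. graded_span W' z N)" using assms(8) by blast
  fix w assume w: "w \<in> (\<Union>N. graded_span W' z N)"
  then obtain M where M: "w \<in> graded_span W' z M" by blast
  {
    fix v assume "v \<in> (\<Union>N. graded_span W z N)"
    then show "v \<otimes> w \<in> (\<Union>N. graded_span W' z N)"
      using graded_span_mult[OF assms(1) W' W' assms(2,7) _ M] by blast
  next
    fix v assume "v \<in> (\<Union>N. graded_span W' z N)"
    then obtain N where *: "v \<in> graded_span W' z N" by blast
    with M have "v \<in> graded_span W' z (max N M)" "w \<in> graded_span W' z (max N M)"
      using graded_span_mono by (meson max.cobounded1 max.cobounded2 order_refl)+
    then show "w \<oplus> v \<in> (\<Union>N. graded_span W' z N)"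
      using graded_span_add[OF W' assms(2)] by blast
  }
qed

lemma (in ring) maximal_proper_ideal_in:
  assumes "proper_ideal_in R A \<nn>"
  obtains V \<mm> where "proper_ideal_in R V \<mm>" "A \<subseteq> V" "\<nn> \<subseteq> \<mm>"
    "\<And>V' \<mm>'. \<lbrakk>proper_ideal_in R V' \<mm>'; V \<subseteq> V'; \<mm> \<subseteq> \<mm>'\<rbrakk> \<Longrightarrow> V' = V"
proof -
  \<comment> \<open>a pair of sets is coded as one set of tagged elements, so that Zorn's lemma for inclusion applies\<close>
  define fib :: "('a \<times> bool) set \<Rightarrow> bool \<Rightarrow> 'a set" where "fib P b = {x. (x, b) \<in> P}" for P b
  define pair where "pair V \<mm> = V \<times> {True} \<union> \<mm> \<times> {False}" for V \<mm> :: "'a set"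
  have fib_pair[simp]: "fib (pair V \<mm>) True = V" "fib (pair V \<mm>) False = \<mm>" for V \<mm>
    by (auto simp: fib_def pair_def)
  define Z where "Z = {P. proper_ideal_in R (fib P True) (fib P False) \<and> A \<subseteq> fib P True \<and> \<nn> \<subseteq> fib P False}"
  have "\<exists>P\<in>Z. \<forall>Q\<in>Z. P \<subseteq> Q \<longrightarrow> Q = P"
  proof (rule subset_Zorn_nonempty)
    have "pair A \<nn> \<in> Z" using assms by (simp add: Z_def)
    then show "Z \<noteq> {}" by blast
  next
    fix C assume C: "C \<noteq> {}" "subset.chain Z C"
    have sub: "P \<in> Z" if "P \<in> C" for P using C that by (auto simp: subset.chain_def)
    have fibU: "fib (\<Union>C) b = (\<Union>P\<in>C. fib P b)" for b by (auto simp: fib_def)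
    have two: "\<exists>Q\<in>C. x \<in> fib Q b \<and> y \<in> fib Q b'" if xy: "x \<in> fib (\<Union>C) b" "y \<in> fib (\<Union>C) b'" for x y b b'
    proof -
      obtain P Q where PQ: "P \<in> C" "x \<in> fib P b" "Q \<in> C" "y \<in> fib Q b'" using xy unfolding fibU by auto
      then have "P \<subseteq> Q \<or> Q \<subseteq> P" using C by (auto simp: subset.chain_def)
      then show ?thesis using PQ by (auto simp: fib_def)
    qed
    have P: "proper_ideal_in R (fib P True) (fib P False)" "A \<subseteq> fib P True" "\<nn> \<subseteq> fib P False"
      if "P \<in> C" for P using sub[OF that] by (auto simp: Z_def)
    have sr: "subring (fib P True) R" if "P \<in> C" for P
      using P(1)[OF that] by (simp add: proper_ideal_in_def)
    have "subring (fib (\<Union>C) True) R"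
    proof (rule subringI)
      show "fib (\<Union>C) True \<subseteq> carrier R" using subringE(1)[OF sr] unfolding fibU by blast
      show "\<one> \<in> fib (\<Union>C) True" using subringE(3)[OF sr] C(1) unfolding fibU by auto
      fix x assume x: "x \<in> fib (\<Union>C) True"
      then show "\<ominus> x \<in> fib (\<Union>C) True" using subringE(5)[OF sr] unfolding fibU by auto
      fix y assume "y \<in> fib (\<Union>C) True"
      then obtain Q where "Q \<in> C" "x \<in> fib Q True" "y \<in> fib Q True" using two x by blast
      then show "x \<otimes> y \<in> fib (\<Union>C) True" "x \<oplus> y \<in> fib (\<Union>C) True"
        using subringE(6,7)[OF sr, of Q x y] unfolding fibU by blast+
    qed
    moreover obtain P0 where "P0 \<in> C" using C(1) by blast
    then have "\<zero> \<in> fib (\<Union>C) False" "A \<subseteq> fib (\<Union>C) True" "\<nn> \<subseteq> fib (\<Union>C) False"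
      using P[of P0] unfolding fibU by (auto simp: proper_ideal_in_def)
    moreover have "fib (\<Union>C) False \<subseteq> fib (\<Union>C) True" "\<one> \<notin> fib (\<Union>C) False"
      using P(1) unfolding fibU by (force simp: proper_ideal_in_def)+
    moreover have "x \<oplus> y \<in> fib (\<Union>C) False" if xy: "x \<in> fib (\<Union>C) False" "y \<in> fib (\<Union>C) False" for x y
    proof -
      obtain Q where "Q \<in> C" "x \<in> fib Q False" "y \<in> fib Q False" using two[OF xy] by blast
      then show ?thesis using P(1)[of Q] unfolding fibU by (force simp: proper_ideal_in_def)
    qed
    moreover have "x \<otimes> y \<in> fib (\<Union>C) False" if xy: "x \<in> fib (\<Union>C) True" "y \<in> fib (\<Union>C) False" for x y
    proof -
      obtain Q where "Q \<in> C" "x \<in> fib Q True" "y \<in> fib Q False" using two[OF xy] by blast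
      then show ?thesis using P(1)[of Q] unfolding fibU by (force simp: proper_ideal_in_def)
    qed
    ultimately show "\<Union>C \<in> Z" by (auto simp: Z_def proper_ideal_in_def)
  qed
  then obtain P where P: "P \<in> Z" "\<And>Q. \<lbrakk>Q \<in> Z; P \<subseteq> Q\<rbrakk> \<Longrightarrow> Q = P" by blast
  show thesis
  proof (rule that)
    show "proper_ideal_in R (fib P True) (fib P False)" "A \<subseteq> fib P True" "\<nn> \<subseteq> fib P False"
      using P(1) by (auto simp: Z_def)
    fix V' \<mm>' assume *: "proper_ideal_in R V' \<mm>'" "fib P True \<subseteq> V'" "fib P False \<subseteq> \<mm>'"
    then have "pair V' \<mm>' \<in> Z" using P(1) by (auto simp: Z_def)
    moreover have "P \<subseteq> pair V' \<mm>'"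
    proof
      fix t assume "t \<in> P"
      then show "t \<in> pair V' \<mm>'" using *(2,3) by (cases t; cases "snd t") (auto simp: fib_def pair_def)
    qed
    ultimately have "pair V' \<mm>' = P" by (rule P(2))
    then show "V' = fib P True" using fib_pair(1) by metis
  qed
qed

text \<open>
  The next lemmas carry the elimination behind Chevalley's theorem. Suppose that \<open>1\<close> is a polynomial in
  \<open>z\<close>, and also one in \<open>y = 1/z\<close>, with coefficients in the ideal \<open>\<mm>\<close>. The relation of larger degree
  can then be shortened by means of the other one.
\<close>

lemma (in cring) graded_span_peel:
  assumes "\<And>x y. \<lbrakk>x \<in> \<mm>; y \<in> \<mm>\<rbrakk> \<Longrightarrow> x \<oplus> y \<in> \<mm>" "\<zero> \<in> \<mm>" "\<mm> \<subseteq> carrier R" "z \<in> carrier R"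
    and "w \<in> graded_span (\<lambda>_. \<mm>) z (Suc N)"
  shows "\<exists>a\<in>\<mm>. \<exists>u\<in>graded_span (\<lambda>_. \<mm>) z N. w = a \<otimes> z [^] Suc N \<oplus> u"
  using assms(5)
proof induction
  case zero
  then show ?case using assms(2-4) by (intro bexI[of _ \<zero>]) (auto intro: graded_span.zero)
next
  case (step i b w)
  then obtain a u where au: "a \<in> \<mm>" "u \<in> graded_span (\<lambda>_. \<mm>) z N" "w = a \<otimes> z [^] Suc N \<oplus> u" by blast
  have c: "a \<in> carrier R" "b \<in> carrier R" "u \<in> carrier R" "z [^] i \<in> carrier R" "z [^] Suc N \<in> carrier R"
    using au step assms graded_span_carrier[OF _ assms(4) au(2)] by auto
  show ?case
  proof (cases "i = Suc N")
    case True
    have "b \<otimes> z [^] i \<oplus> w = (b \<oplus> a) \<otimes> z [^] Suc N \<oplus> u"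
      using c au(3) True by (simp add: l_distr a_assoc del: nat_pow_Suc)
    then show ?thesis using assms(1) step au by blast
  next
    case False
    have "b \<otimes> z [^] i \<oplus> w = a \<otimes> z [^] Suc N \<oplus> (b \<otimes> z [^] i \<oplus> u)"
      using c au(3) by (simp add: a_lcomm del: nat_pow_Suc)
    moreover have "b \<otimes> z [^] i \<oplus> u \<in> graded_span (\<lambda>_. \<mm>) z N"
      using False step au by (intro graded_span.step) auto
    ultimately show ?thesis using au by blast
  qed
qed

lemma (in cring) pow_mult_inverse_pow:
  fixes m n :: nat
  assumes "z \<in> carrier R" "y \<in> carrier R" "z \<otimes> y = \<one>" "m \<le> n"
  shows "z [^] n \<otimes> y [^] m = z [^] (n - m)"
proof -
  have "z [^] n = z [^] (n - m) \<otimes> z [^] m" using nat_pow_mult[OF assms(1), of "n - m" m] assms(4) by simp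
  moreover have "z [^] m \<otimes> y [^] m = \<one>"
    using assms by (simp add: nat_pow_distrib[symmetric])
  ultimately show ?thesis using assms by (simp add: m_assoc)
qed

text \<open>
  Multiplication by \<open>z\<^sup>n\<^sup>+\<^sup>1\<close> turns all terms of a polynomial in \<open>y = 1/z\<close> except the constant one into
  terms of degree at most \<open>n\<close> in \<open>z\<close>.
\<close>

lemma (in cring) graded_span_inverse:
  assumes "\<And>x y. \<lbrakk>x \<in> \<mm>; y \<in> \<mm>\<rbrakk> \<Longrightarrow> x \<oplus> y \<in> \<mm>" "\<zero> \<in> \<mm>" "\<mm> \<subseteq> carrier R"
    and "z \<in> carrier R" "y \<in> carrier R" "z \<otimes> y = \<one>" "m \<le> Suc n"
    and "w \<in> graded_span (\<lambda>_. \<mm>) y m"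
  shows "\<exists>b\<in>\<mm>. \<exists>u\<in>graded_span (\<lambda>_. \<mm>) z n. z [^] Suc n \<otimes> w = z [^] Suc n \<otimes> b \<oplus> u"
  using assms(8)
proof induction
  case zero
  then show ?case using assms by (intro bexI[of _ \<zero>]) (auto intro: graded_span.zero)
next
  case (step i a w)
  then obtain b u where bu: "b \<in> \<mm>" "u \<in> graded_span (\<lambda>_. \<mm>) z n"
      "z [^] Suc n \<otimes> w = z [^] Suc n \<otimes> b \<oplus> u" by blast
  have c: "a \<in> carrier R" "b \<in> carrier R" "u \<in> carrier R" "w \<in> carrier R" "z [^] Suc n \<in> carrier R"
      "y [^] i \<in> carrier R"
    using bu step assms graded_span_carrier[OF _ assms(4) bu(2)]
      graded_span_carrier[OF _ assms(5) step(3)] by auto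
  have e: "z [^] Suc n \<otimes> (a \<otimes> y [^] i \<oplus> w) = a \<otimes> z [^] (Suc n - i) \<oplus> (z [^] Suc n \<otimes> b \<oplus> u)"
  proof -
    have "z [^] Suc n \<otimes> (a \<otimes> y [^] i) = a \<otimes> (z [^] Suc n \<otimes> y [^] i)"
      using c by (simp add: m_lcomm del: nat_pow_Suc)
    also have "\<dots> = a \<otimes> z [^] (Suc n - i)"
      using pow_mult_inverse_pow[OF assms(4-6), of i "Suc n"] step(1) assms(7) by (simp del: nat_pow_Suc)
    finally show ?thesis using c bu(3) by (simp add: r_distr del: nat_pow_Suc)
  qed
  show ?case
  proof (cases "i = 0")
    case True
    have "z [^] Suc n \<otimes> (a \<otimes> y [^] i \<oplus> w) = z [^] Suc n \<otimes> (a \<oplus> b) \<oplus> u"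
      unfolding e using True c m_comm[OF c(1) c(5)] by (simp add: r_distr a_assoc del: nat_pow_Suc)
    then show ?thesis using bu step assms(1) by blast
  next
    case False
    have "z [^] Suc n \<otimes> (a \<otimes> y [^] i \<oplus> w) = z [^] Suc n \<otimes> b \<oplus> (a \<otimes> z [^] (Suc n - i) \<oplus> u)"
      unfolding e using assms(4) c by (simp add: a_lcomm del: nat_pow_Suc)
    moreover have "a \<otimes> z [^] (Suc n - i) \<oplus> u \<in> graded_span (\<lambda>_. \<mm>) z n"
      using False step bu by (intro graded_span.step) auto
    ultimately show ?thesis using bu by blast
  qed
qed

text \<open>
  Write \<open>1 = a z\<^sup>n\<^sup>+\<^sup>1 + u\<close> with \<open>u\<close> of degree at most \<open>n\<close>, and let \<open>b\<close> be the constant term of the relation in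
  \<open>y\<close>. That relation expresses \<open>(1 - b) z\<^sup>n\<^sup>+\<^sup>1\<close> in degree at most \<open>n\<close>; hence so is
  \<open>1 - b = a (1 - b) z\<^sup>n\<^sup>+\<^sup>1 + (1 - b) u\<close>, and \<open>b\<close> is a constant of \<open>\<mm>\<close>. The factor
  \<open>1 - b\<close> takes the place of dividing by \<open>1 - b\<close>, which need not be a unit.
\<close>

lemma (in cring) elimination_step:
  assumes "proper_ideal_in R V \<mm>" and zy: "z \<in> carrier R" "y \<in> carrier R" "z \<otimes> y = \<one>" 
    and "m \<le> Suc n" "\<one> \<in> graded_span (\<lambda>_. \<mm>) z (Suc n)" "\<one> \<in> graded_span (\<lambda>_. \<mm>) y m"
  shows "\<one> \<in> graded_span (\<lambda>_. \<mm>) z n"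
proof -
  have \<mm>: "\<And>x y. \<lbrakk>x \<in> \<mm>; y \<in> \<mm>\<rbrakk> \<Longrightarrow> x \<oplus> y \<in> \<mm>" "\<zero> \<in> \<mm>" "\<And>a x. \<lbrakk>a \<in> V; x \<in> \<mm>\<rbrakk> \<Longrightarrow> a \<otimes> x \<in> \<mm>"
      and V: "subring V R" "\<mm> \<subseteq> V"
    using assms(1) by (auto simp: proper_ideal_in_def)
  have \<mm>R: "\<mm> \<subseteq> carrier R" using V subringE(1) by blast
  have VR: "V \<subseteq> carrier R" using V subringE(1) by blast
  let ?P = "graded_span (\<lambda>_. \<mm>) z n"
  obtain a u where a: "a \<in> \<mm>" "u \<in> ?P" "\<one> = a \<otimes> z [^] Suc n \<oplus> u"
    using graded_span_peel[OF \<mm>(1,2) \<mm>R zy(1) assms(6)] by auto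
  obtain b w where b: "b \<in> \<mm>" "w \<in> ?P" "z [^] Suc n \<otimes> \<one> = z [^] Suc n \<otimes> b \<oplus> w"
    using graded_span_inverse[OF \<mm>(1,2) \<mm>R zy assms(5,7)] by auto
  have \<mm>R': "\<forall>i::nat. \<mm> \<subseteq> carrier R" using \<mm>R by simp
  note Pc = graded_span_carrier[where W = "\<lambda>_. \<mm>", OF \<mm>R' zy(1)]
    and Padd = graded_span_add[where W = "\<lambda>_. \<mm>", OF \<mm>R' zy(1)]
  have mul: "c \<otimes> v \<in> ?P" if "c \<in> V" "v \<in> ?P" for c v
  proof -
    have "c \<in> graded_span (\<lambda>i. if i = 0 then V else {\<zero>}) z 0"
      using graded_span_single[of 0 0 c "\<lambda>i. if i = 0 then V else {\<zero>}" z] that VR zy by auto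
    then have "c \<otimes> v \<in> graded_span (\<lambda>_. \<mm>) z (0 + n)"
      using that VR \<mm> \<mm>R zy
      by (intro graded_span_mult[where ?W1.0 = "\<lambda>i. if i = 0 then V else {\<zero>}" and ?W2.0 = "\<lambda>_. \<mm>"])
         (auto split: if_splits)
    then show ?thesis by simp
  qed
  define c where "c = \<one> \<ominus> b"
  have cR: "a \<in> carrier R" "b \<in> carrier R" "u \<in> carrier R" "w \<in> carrier R" "z [^] Suc n \<in> carrier R"
    using a(1,2) b(1,2) \<mm>R Pc zy by auto
  have c: "c \<in> V" "c \<in> carrier R"
    using b V subringE(3,5,7)[OF V(1)] VR by (auto simp: c_def a_minus_def)
  have cz: "c \<otimes> z [^] Suc n = w"
  proof -
    have "c \<otimes> z [^] Suc n = z [^] Suc n \<otimes> \<one> \<ominus> z [^] Suc n \<otimes> b"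
      using cR m_comm[OF c(2) cR(5)] by (simp add: c_def a_minus_def r_distr r_minus del: nat_pow_Suc)
    also have "\<dots> = w" unfolding b(3) using cR by (simp add: a_minus_def a_assoc a_lcomm r_neg del: nat_pow_Suc)
    finally show ?thesis .
  qed
  have "c = c \<otimes> (a \<otimes> z [^] Suc n \<oplus> u)" using a(3)[symmetric] c by simp
  also have "\<dots> = a \<otimes> (c \<otimes> z [^] Suc n) \<oplus> c \<otimes> u"
    using cR c by (simp add: r_distr m_lcomm del: nat_pow_Suc)
  finally have "c \<in> ?P"
    unfolding cz using Padd[OF mul mul, of a w c u] a(1,2) b(2) c(1) V(2) by auto
  moreover have "b \<in> ?P"
    using graded_span_single[of 0 n b "\<lambda>_. \<mm>" z] b \<mm>R zy cR by auto
  moreover have "\<one> = c \<oplus> b" using cR by (simp add: c_def a_minus_def a_assoc l_neg)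
  ultimately show ?thesis using Padd by metis
qed

lemma (in cring) one_not_in_both_spans:
  assumes "proper_ideal_in R V \<mm>" and "z \<in> carrier R" "y \<in> carrier R" "z \<otimes> y = \<one>" 
  shows "\<not> (\<one> \<in> graded_span (\<lambda>_. \<mm>) z n \<and> \<one> \<in> graded_span (\<lambda>_. \<mm>) y m)"
  using assms(2-)
proof (induction "n + m" arbitrary: n m z y rule: less_induct)
  case less
  show ?case
  proof
    assume H: "\<one> \<in> graded_span (\<lambda>_. \<mm>) z n \<and> \<one> \<in> graded_span (\<lambda>_. \<mm>) y m"
    have \<mm>: "\<And>x y. \<lbrakk>x \<in> \<mm>; y \<in> \<mm>\<rbrakk> \<Longrightarrow> x \<oplus> y \<in> \<mm>" "\<zero> \<in> \<mm>" "\<one> \<notin> \<mm>"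
      and sub: "subring V R" "\<mm> \<subseteq> V"
      using assms(1) by (simp_all add: proper_ideal_in_def)
    then have \<mm>R: "\<mm> \<subseteq> carrier R" using subringE(1) by blast
    have zero: "\<one> \<notin> graded_span (\<lambda>_. \<mm>) x 0" if "x \<in> carrier R" for x
    proof -
      have "w \<in> \<mm>" if "w \<in> graded_span (\<lambda>_. \<mm>) x 0" for w
        using that by induction (use \<mm>(1,2) \<mm>R \<open>x \<in> carrier R\<close> in \<open>auto simp: subset_iff\<close>)
      then show ?thesis using \<mm>(3) by blast
    qed
    have yz: "y \<otimes> z = \<one>" using less.prems by (simp add: m_comm)
    show False
    proof (cases "m \<le> n")
      case True
      then obtain k where k: "n = Suc k" using H zero less.prems by (cases n) auto
      then have "\<one> \<in> graded_span (\<lambda>_. \<mm>) z k"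
        using elimination_step[OF assms(1) less.prems(1-3), of m k] H True by simp
      then show False using less.hyps[of k m z y] less.prems H k by simp
    next
      case False
      then obtain k where k: "m = Suc k" by (cases m) auto
      then have "\<one> \<in> graded_span (\<lambda>_. \<mm>) y k"
        using elimination_step[OF assms(1) less.prems(2,1) yz, of n k] H False by simp
      then show False using less.hyps[of n k z y] less.prems H k by simp
    qed
  qed
qed

text \<open>
  A maximal pair \<open>(V, \<mm>)\<close> is a valuation ring: if \<open>1\<close> does not lie in \<open>\<mm>[z]\<close>, then \<open>(V[z], \<mm>[z])\<close> is
  again a pair, so \<open>z \<in> V\<close> by maximality; and the elimination shows that \<open>1\<close> cannot lie in both \<open>\<mm>[z]\<close>
  and \<open>\<mm>[1/z]\<close>. The last property says that the elements of the given ideal are not units of \<open>V\<close>.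
\<close>

theorem (in cring) Chevalley_extension:
  assumes "proper_ideal_in R A \<nn>"
  obtains V where "valuation_ring R V" "A \<subseteq> V" "\<And>x y. \<lbrakk>x \<in> \<nn>; y \<in> V\<rbrakk> \<Longrightarrow> y \<otimes> x \<noteq> \<one>"
proof -
  obtain V \<mm> where V: "proper_ideal_in R V \<mm>" "A \<subseteq> V" "\<nn> \<subseteq> \<mm>"
    and max: "\<And>V' \<mm>'. \<lbrakk>proper_ideal_in R V' \<mm>'; V \<subseteq> V'; \<mm> \<subseteq> \<mm>'\<rbrakk> \<Longrightarrow> V' = V"
    using maximal_proper_ideal_in[OF assms] by metis
  have sr: "subring V R" "\<mm> \<subseteq> V" using V(1) by (auto simp: proper_ideal_in_def)
  note srE = subringE[OF sr(1)]
  have adjoin: "z \<in> V" if z: "z \<in> carrier R" "\<And>N. \<one> \<notin> graded_span (\<lambda>_. \<mm>) z N" for z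
  proof -
    let ?V = "\<Union>N. graded_span (\<lambda>_. V) z N" and ?\<mm> = "\<Union>N. graded_span (\<lambda>_. \<mm>) z N"
    have *: "x \<in> (\<Union>N. graded_span (\<lambda>_. Y) z N)" if "x \<in> Y" "Y \<subseteq> carrier R" for x Y
      using graded_span_single[of 0 0 x "\<lambda>_. Y" z] that z by (auto simp: subset_iff)
    have "proper_ideal_in R ?V ?\<mm>"
      by (rule graded_span_proper_ideal) (use V(1) sr srE(1,3,5,6) z in \<open>auto simp: proper_ideal_in_def\<close>)
    moreover have "V \<subseteq> ?V" "\<mm> \<subseteq> ?\<mm>" using * srE(1) sr(2) by blast+
    ultimately have "?V = V" by (rule max)
    moreover have "\<one> \<otimes> z [^] (1::nat) \<in> graded_span (\<lambda>_. V) z 1"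
      using graded_span_single[of 1 1 \<one> "\<lambda>_. V" z] z srE by auto
    ultimately show "z \<in> V" using z by auto
  qed
  show thesis
  proof (rule that)
    show "valuation_ring R V"
      unfolding valuation_ring_def
    proof (intro conjI ballI impI)
      fix z y assume "z \<in> carrier R" "y \<in> carrier R" "z \<otimes> y = \<one>"
      then show "z \<in> V \<or> y \<in> V"
        using adjoin[of z] adjoin[of y] one_not_in_both_spans[OF V(1), of z y] by blast
    qed (rule sr)
    show "A \<subseteq> V" by fact
    show "y \<otimes> x \<noteq> \<one>" if "x \<in> \<nn>" "y \<in> V" for x y
      using that V unfolding proper_ideal_in_def by (metis subsetD)
  qed
qed

section \<open>The valuation of a valuation ring\<close>

lemma valuation_ringE:
  assumes "valuation_ring F V"
  shows "subring V F" "V \<subseteq> carrier F" "\<zero>\<^bsub>F\<^esub> \<in> V" "\<one>\<^bsub>F\<^esub> \<in> V"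
    "\<And>x. x \<in> V \<Longrightarrow> \<ominus>\<^bsub>F\<^esub> x \<in> V"
    "\<And>x y. \<lbrakk>x \<in> V; y \<in> V\<rbrakk> \<Longrightarrow> x \<otimes>\<^bsub>F\<^esub> y \<in> V" "\<And>x y. \<lbrakk>x \<in> V; y \<in> V\<rbrakk> \<Longrightarrow> x \<oplus>\<^bsub>F\<^esub> y \<in> V"
    "\<And>x y. \<lbrakk>x \<in> carrier F; y \<in> carrier F; x \<otimes>\<^bsub>F\<^esub> y = \<one>\<^bsub>F\<^esub>\<rbrakk> \<Longrightarrow> x \<in> V \<or> y \<in> V"
proof -
  show sr: "subring V F" using assms by (simp add: valuation_ring_def)
  note E = subringE[OF sr]
  show "V \<subseteq> carrier F" "\<zero>\<^bsub>F\<^esub> \<in> V" "\<one>\<^bsub>F\<^esub> \<in> V"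
    "\<And>x. x \<in> V \<Longrightarrow> \<ominus>\<^bsub>F\<^esub> x \<in> V"
    "\<And>x y. \<lbrakk>x \<in> V; y \<in> V\<rbrakk> \<Longrightarrow> x \<otimes>\<^bsub>F\<^esub> y \<in> V" "\<And>x y. \<lbrakk>x \<in> V; y \<in> V\<rbrakk> \<Longrightarrow> x \<oplus>\<^bsub>F\<^esub> y \<in> V"
    by (rule E; assumption?)+
  show "x \<in> V \<or> y \<in> V" if "x \<in> carrier F" "y \<in> carrier F" "x \<otimes>\<^bsub>F\<^esub> y = \<one>\<^bsub>F\<^esub>" for x y
    using assms that by (simp add: valuation_ring_def)
qed

lemma (in ring) subring_pow_closed:
  fixes n :: nat
  assumes "subring V R" "x \<in> V"
  shows "x [^] n \<in> V"
  by (induction n) (use subringE(3,6)[OF assms(1)] assms(2) in auto)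

lemma (in field) inverseE:
  assumes "x \<in> carrier R" "x \<noteq> \<zero>"
  obtains y where "y \<in> carrier R" "y \<noteq> \<zero>" "x \<otimes> y = \<one>"
proof -
  have "x \<in> Units R" using assms by (simp add: field_Units)
  then obtain y where "y \<in> carrier R" "x \<otimes> y = \<one>" by (auto simp: Units_def)
  moreover from this have "y \<noteq> \<zero>" using assms by auto
  ultimately show thesis using that by blast
qed

text \<open>
  The value of \<open>x\<close> is the fractional principal ideal \<open>x V\<close>, and values are ordered by reverse inclusion.
  This is the usual value group \<open>F\<^sup>\<times> / V\<^sup>\<times>\<close>, but antisymmetry of the order and the group laws are
  immediate from those of sets, and values are sets of field elements, the kind of value over which
  \<^const>\<open>frac_power\<close> quantifies.
\<close>

definition principal :: "('l, 'k) ring_scheme \<Rightarrow> 'l set \<Rightarrow> 'l \<Rightarrow> 'l set" where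
  "principal F V x = (\<lambda>v. x \<otimes>\<^bsub>F\<^esub> v) ` V"

definition value_group :: "('l, 'k) ring_scheme \<Rightarrow> 'l set \<Rightarrow> 'l set monoid" where
  "value_group F V =
     \<lparr>carrier = principal F V ` (carrier F - {\<zero>\<^bsub>F\<^esub>}), monoid.mult = set_mult F, one = V\<rparr>"

definition value_order :: "('l, 'k) ring_scheme \<Rightarrow> 'l set \<Rightarrow> ('l set \<times> 'l set) set" where
  "value_order F V = {(P, Q). P \<in> carrier (value_group F V) \<and> Q \<in> carrier (value_group F V) \<and> Q \<subseteq> P}"

definition ring_valuation :: "('l, 'k) ring_scheme \<Rightarrow> 'l set \<Rightarrow> 'l \<Rightarrow> 'l set option" where
  "ring_valuation F V x = (if x = \<zero>\<^bsub>F\<^esub> then None else Some (principal F V x))"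

context
  fixes F (structure) and V
  assumes F: "field F" and V: "valuation_ring F V"
begin

interpretation field F by (rule F)

private lemma Vc: "v \<in> V \<Longrightarrow> v \<in> carrier F" using valuation_ringE(2)[OF V] by blast

private lemma principal_subset_iff:
  assumes "x \<in> carrier F" "y \<in> carrier F"
  shows "principal F V y \<subseteq> principal F V x \<longleftrightarrow> y \<in> principal F V x"
proof
  assume "principal F V y \<subseteq> principal F V x"
  moreover have "y \<in> principal F V y"
    using valuation_ringE(4)[OF V] assms by (auto simp: principal_def intro!: image_eqI[of _ _ \<one>])
  ultimately show "y \<in> principal F V x" by blast
next
  assume "y \<in> principal F V x"
  then obtain v where v: "v \<in> V" "y = x \<otimes> v" by (auto simp: principal_def)
  show "principal F V y \<subseteq> principal F V x"
  proof
    fix u assume "u \<in> principal F V y"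
    then obtain w where "w \<in> V" "u = y \<otimes> w" by (auto simp: principal_def)
    then show "u \<in> principal F V x"
      using v assms Vc valuation_ringE(6)[OF V]
      by (auto simp: principal_def m_assoc intro!: image_eqI[of _ _ "v \<otimes> w"])
  qed
qed

private lemma principal_mult:
  assumes "x \<in> carrier F" "y \<in> carrier F"
  shows "principal F V x <#> principal F V y = principal F V (x \<otimes> y)"
proof
  show "principal F V x <#> principal F V y \<subseteq> principal F V (x \<otimes> y)"
  proof
    fix u assume "u \<in> principal F V x <#> principal F V y"
    then obtain v w where vw: "v \<in> V" "w \<in> V" "u = (x \<otimes> v) \<otimes> (y \<otimes> w)"
      by (auto simp: set_mult_def principal_def)
    then have "u = (x \<otimes> y) \<otimes> (v \<otimes> w)" using assms Vc by (simp add: m_ac)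
    then show "u \<in> principal F V (x \<otimes> y)"
      using vw valuation_ringE(6)[OF V] by (auto simp: principal_def)
  qed
  show "principal F V (x \<otimes> y) \<subseteq> principal F V x <#> principal F V y"
  proof
    fix u assume "u \<in> principal F V (x \<otimes> y)"
    then obtain v where v: "v \<in> V" "u = x \<otimes> y \<otimes> v" by (auto simp: principal_def)
    then have "u = (x \<otimes> \<one>) \<otimes> (y \<otimes> v)" using assms Vc by (simp add: m_assoc)
    then show "u \<in> principal F V x <#> principal F V y"
      using v valuation_ringE(4)[OF V] unfolding set_mult_def principal_def by blast
  qed
qed

private lemma principal_one: "principal F V \<one> = V"
  using Vc by (force simp: principal_def)

private lemma principal_total:
  assumes "x \<in> carrier F" "y \<in> carrier F"
  shows "y \<in> principal F V x \<or> x \<in> principal F V y"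
proof (cases "x = \<zero> \<or> y = \<zero>")
  case True
  then show ?thesis
    using assms valuation_ringE(3)[OF V] by (auto simp: principal_def intro!: image_eqI[of _ _ \<zero>])
next
  case False
  then obtain x' y' where i: "x' \<in> carrier F" "x \<otimes> x' = \<one>" "y' \<in> carrier F" "y \<otimes> y' = \<one>"
    using assms inverseE by metis
  have "(x \<otimes> y') \<otimes> (y \<otimes> x') = (x \<otimes> x') \<otimes> (y \<otimes> y')" using i(1,3) assms by (simp add: m_ac)
  then have "x \<otimes> y' \<in> V \<or> y \<otimes> x' \<in> V"
    using i assms by (intro valuation_ringE(8)[OF V]) auto
  moreover have "x = y \<otimes> (x \<otimes> y')" "y = x \<otimes> (y \<otimes> x')"
    using i assms m_lcomm[of y x y'] m_lcomm[of x y x'] by simp_all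
  ultimately show ?thesis unfolding principal_def by (metis image_eqI)
qed

lemma ring_valuation_le_iff:
  assumes "x \<in> carrier F" "y \<in> carrier F"
  shows "ext_le (value_order F V) (ring_valuation F V x) (ring_valuation F V y) \<longleftrightarrow> (\<exists>v\<in>V. y = x \<otimes> v)"
proof -
  have *: "(\<exists>v\<in>V. y = x \<otimes> v) \<longleftrightarrow> y \<in> principal F V x" by (auto simp: principal_def)
  show ?thesis
  proof (cases "y = \<zero>")
    case True
    then show ?thesis unfolding * using assms valuation_ringE(3)[OF V]
      by (auto simp: ext_le_def ring_valuation_def principal_def intro!: image_eqI[of _ _ \<zero>])
  next
    case y: False
    show ?thesis
    proof (cases "x = \<zero>")
      case True
      then have "y \<notin> principal F V x" using y Vc by (auto simp: principal_def)
      then show ?thesis using True y unfolding * by (simp add: ext_le_def ring_valuation_def)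
    next
      case False
      then show ?thesis using y assms unfolding *
        by (simp add: ext_le_def ring_valuation_def value_order_def value_group_def
            principal_subset_iff)
    qed
  qed
qed

lemma ring_valuation_is_valuation:
  "field_valuation F (value_group F V) (value_order F V) (ring_valuation F V)"
proof -
  let ?G = "value_group F V"
  have carr: "carrier ?G = principal F V ` (carrier F - {\<zero>})" and one: "\<one>\<^bsub>?G\<^esub> = principal F V \<one>"
    by (simp_all add: value_group_def principal_one)
  have mult: "principal F V x \<otimes>\<^bsub>?G\<^esub> principal F V y = principal F V (x \<otimes> y)"
    if "x \<in> carrier F" "y \<in> carrier F" for x y
    using principal_mult[OF that] by (simp add: value_group_def)
  have nz: "x \<otimes> y \<noteq> \<zero>" if "x \<in> carrier F" "y \<in> carrier F" "x \<noteq> \<zero>" "y \<noteq> \<zero>" for x y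
    using that integral by blast
  have in_carr: "principal F V x \<in> carrier ?G" if "x \<in> carrier F" "x \<noteq> \<zero>" for x
    using that by (simp add: carr)
  have comm: "comm_group ?G"
  proof (rule comm_groupI)
    fix P Q assume "P \<in> carrier ?G" "Q \<in> carrier ?G"
    then obtain x y where xy: "x \<in> carrier F" "x \<noteq> \<zero>" "P = principal F V x"
        "y \<in> carrier F" "y \<noteq> \<zero>" "Q = principal F V y"
      by (auto simp: carr)
    then show "P \<otimes>\<^bsub>?G\<^esub> Q \<in> carrier ?G" "P \<otimes>\<^bsub>?G\<^esub> Q = Q \<otimes>\<^bsub>?G\<^esub> P"
      by (auto simp: mult m_comm intro!: in_carr dest: nz)
  next
    fix P Q T assume "P \<in> carrier ?G" "Q \<in> carrier ?G" "T \<in> carrier ?G"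
    then obtain x y z where "x \<in> carrier F" "P = principal F V x"
        "y \<in> carrier F" "Q = principal F V y" "z \<in> carrier F" "T = principal F V z"
      by (auto simp: carr)
    then show "P \<otimes>\<^bsub>?G\<^esub> Q \<otimes>\<^bsub>?G\<^esub> T = P \<otimes>\<^bsub>?G\<^esub> (Q \<otimes>\<^bsub>?G\<^esub> T)" by (simp add: mult m_assoc)
  next
    show "\<one>\<^bsub>?G\<^esub> \<in> carrier ?G" by (simp add: one in_carr)
    fix P assume "P \<in> carrier ?G"
    then obtain x where x: "x \<in> carrier F" "x \<noteq> \<zero>" "P = principal F V x" by (auto simp: carr)
    then show "\<one>\<^bsub>?G\<^esub> \<otimes>\<^bsub>?G\<^esub> P = P" by (simp add: one mult)
    obtain y where "y \<in> carrier F" "y \<noteq> \<zero>" "x \<otimes> y = \<one>" using inverseE x by blast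
    then show "\<exists>Q\<in>carrier ?G. Q \<otimes>\<^bsub>?G\<^esub> P = \<one>\<^bsub>?G\<^esub>"
      using x by (intro bexI[of _ "principal F V y"]) (auto simp: one mult m_comm intro: in_carr)
  qed
  have lin: "linear_order_on (carrier ?G) (value_order F V)"
    unfolding order_on_defs
  proof (intro conjI)
    show "refl_on (carrier ?G) (value_order F V)" by (auto simp: refl_on_def value_order_def)
    show "trans (value_order F V)" by (auto simp: trans_def value_order_def)
    show "antisym (value_order F V)" by (auto simp: antisym_def value_order_def)
    show "value_order F V \<subseteq> carrier ?G \<times> carrier ?G" by (auto simp: value_order_def)
    show "total_on (carrier ?G) (value_order F V)"
    proof (rule total_onI)
      fix P Q assume "P \<in> carrier ?G" "Q \<in> carrier ?G"
      then obtain x y where "x \<in> carrier F" "x \<noteq> \<zero>" "P = principal F V x"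
          "y \<in> carrier F" "y \<noteq> \<zero>" "Q = principal F V y"
        by (auto simp: carr)
      then show "(P, Q) \<in> value_order F V \<or> (Q, P) \<in> value_order F V"
        using principal_total[of x y] by (auto simp: value_order_def in_carr principal_subset_iff)
    qed
  qed
  show ?thesis
  proof (intro field_valuation.intro ordered_comm_group.intro field_valuation_axioms.intro
      ordered_comm_group_axioms.intro)
    show "field F" by (rule F)
    show "comm_group ?G" by (rule comm)
    show "linear_order_on (carrier ?G) (value_order F V)" by (rule lin)
    fix P Q T assume "(P, Q) \<in> value_order F V" "T \<in> carrier ?G"
    moreover from this have "P \<otimes>\<^bsub>?G\<^esub> T \<in> carrier ?G" "Q \<otimes>\<^bsub>?G\<^esub> T \<in> carrier ?G"
      using comm_groupE(1)[OF comm] by (auto simp: value_order_def)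
    ultimately show "(P \<otimes>\<^bsub>?G\<^esub> T, Q \<otimes>\<^bsub>?G\<^esub> T) \<in> value_order F V"
      by (auto simp: value_order_def value_group_def set_mult_def)
  next
    show "ring_valuation F V \<zero> = None" by (simp add: ring_valuation_def)
  next
    fix x assume "x \<in> carrier F - {\<zero>}"
    then show "ring_valuation F V x \<in> Some ` carrier ?G" by (auto simp: ring_valuation_def in_carr)
  next
    fix x y assume xy: "x \<in> carrier F" "y \<in> carrier F"
    then show "ring_valuation F V (x \<otimes> y) = ext_add ?G (ring_valuation F V x) (ring_valuation F V y)"
      by (auto simp: ring_valuation_def ext_add_def mult dest: nz)
    have *: "\<exists>v\<in>V. a \<oplus> b = a \<otimes> v" if "b \<in> principal F V a" "a \<in> carrier F" for a b
    proof -
      obtain v where "v \<in> V" "b = a \<otimes> v" using \<open>b \<in> principal F V a\<close> by (auto simp: principal_def)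
      then show ?thesis
        using valuation_ringE(4,7)[OF V] Vc that
        by (intro bexI[of _ "\<one> \<oplus> v"]) (auto simp: r_distr)
    qed
    show "ext_le (value_order F V) (ring_valuation F V x) (ring_valuation F V (x \<oplus> y)) \<or>
          ext_le (value_order F V) (ring_valuation F V y) (ring_valuation F V (x \<oplus> y))"
      using principal_total[OF xy] *[of y x] *[of x y] xy
      by (auto simp: ring_valuation_le_iff a_comm)
  qed
qed

lemma ring_valuation_nonneg_on:
  assumes "A \<subseteq> V"
  shows "nonneg_on (value_group F V) (value_order F V) (ring_valuation F V) A"
proof -
  have "ring_valuation F V \<one> = Some \<one>\<^bsub>value_group F V\<^esub>"
    by (simp add: ring_valuation_def value_group_def principal_one)
  moreover have "ext_le (value_order F V) (ring_valuation F V \<one>) (ring_valuation F V x)" if "x \<in> A" for x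
    using that assms Vc by (subst ring_valuation_le_iff) auto
  ultimately show ?thesis by (simp add: nonneg_on_def)
qed

end

lemma (in field_valuation) v_one: "v \<one>\<^bsub>F\<^esub> = Some \<one>\<^bsub>G\<^esub>"
proof -
  obtain g where g: "g \<in> carrier G" "v \<one>\<^bsub>F\<^esub> = Some g"
    using v_nonzero[of "\<one>\<^bsub>F\<^esub>"] by auto
  have "v (\<one>\<^bsub>F\<^esub> \<otimes>\<^bsub>F\<^esub> \<one>\<^bsub>F\<^esub>) = Some (g \<otimes>\<^bsub>G\<^esub> g)"
    unfolding v_mult[OF F.one_closed F.one_closed] by (simp add: g ext_add_def)
  with g show ?thesis by simp
qed

lemma (in field_valuation) ext_nmul_v:
  assumes "x \<in> carrier F"
  shows "ext_nmul G n (v x) = v (x [^]\<^bsub>F\<^esub> n)"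
  by (induction n) (use assms in \<open>simp_all add: v_one v_mult\<close>)

section \<open>Integral dependence and valuation rings\<close>

text \<open>
  Chevalley's theorem for the Rees-type ring \<open>\<Sum> W i y\<^sup>i\<close> and its ideal of elements without constant term.
  If this ideal is proper, the elements \<open>u y\<close> with \<open>u \<in> W 1\<close> become non-units of a valuation ring.
\<close>

lemma (in field) exists_valuation_ring_inverse:
  assumes A: "subring A R" and W: "W 0 = A" "\<forall>i. W i \<subseteq> carrier R"
      "\<forall>i. \<forall>a\<in>W i. \<ominus> a \<in> W i" "\<forall>i j. \<forall>a\<in>W i. \<forall>b\<in>W j. a \<otimes> b \<in> W (i + j)" "\<forall>i. \<zero> \<in> W i"
    and y: "y \<in> carrier R"
    and one: "\<And>N. \<one> \<notin> graded_span (W(0 := {\<zero>})) y N"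
  obtains V where "valuation_ring R V" "A \<subseteq> V" "\<And>u v. \<lbrakk>u \<in> W 1; v \<in> V\<rbrakk> \<Longrightarrow> v \<otimes> (u \<otimes> y) \<noteq> \<one>"
proof -
  define W' where "W' = W(0 := {\<zero>})"
  have sub: "\<forall>i. W' i \<subseteq> W i" using W(5) by (simp add: W'_def)
  then have W'R: "\<forall>i. W' i \<subseteq> carrier R" using W(2) by blast
  have "proper_ideal_in R (\<Union>N. graded_span W y N) (\<Union>N. graded_span W' y N)"
  proof (rule graded_span_proper_ideal[OF W(2) y _ W(3,4) sub])
    show "\<one> \<in> W 0" using subringE(3)[OF A] W(1) by simp
    show "\<forall>i j. \<forall>a\<in>W i. \<forall>b\<in>W' j. a \<otimes> b \<in> W' (i + j)"
    proof (intro allI ballI)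
      fix i j a b assume ab: "a \<in> W i" "b \<in> W' j"
      show "a \<otimes> b \<in> W' (i + j)"
      proof (cases "j = 0")
        case True
        then have "a \<otimes> b = \<zero>" using ab W(2) by (auto simp: W'_def subset_iff)
        then show ?thesis using W(5) by (simp add: W'_def)
      next
        case False
        then show ?thesis using ab W(4) by (simp add: W'_def)
      qed
    qed
    show "\<one> \<notin> graded_span W' y N" for N using one by (simp add: W'_def)
  qed
  then obtain V where V: "valuation_ring R V" "(\<Union>N. graded_span W y N) \<subseteq> V"
      "\<And>x v. \<lbrakk>x \<in> (\<Union>N. graded_span W' y N); v \<in> V\<rbrakk> \<Longrightarrow> v \<otimes> x \<noteq> \<one>"
    using Chevalley_extension by metis
  show thesis
  proof (rule that[OF V(1)])
    show "A \<subseteq> V"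
    proof
      fix a assume "a \<in> A"
      then have "a \<otimes> y [^] (0::nat) \<in> graded_span W y 0"
        using W(1,2) y by (intro graded_span_single) auto
      moreover have "a \<otimes> y [^] (0::nat) = a" using \<open>a \<in> A\<close> subringE(1)[OF A] by auto
      ultimately show "a \<in> V" using V(2) by auto
    qed
    fix u v assume uv: "u \<in> W 1" "v \<in> V"
    have "u \<otimes> y [^] (1::nat) \<in> graded_span W' y 1"
      using uv W(2) y by (intro graded_span_single) (auto simp: W'_def)
    moreover have "u \<otimes> y [^] (1::nat) = u \<otimes> y" using y by simp
    ultimately show "v \<otimes> (u \<otimes> y) \<noteq> \<one>" using V(3) uv(2) by auto
  qed
qed

text \<open>
  Clearing denominators: here \<open>y = 1/x\<close>, and the constant coefficient is zero, so that every term of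
  \<open>x\<^sup>k w\<close> has the form \<open>a x\<^sup>k\<^sup>-\<^sup>i\<close> with \<open>i > 0\<close>. The target \<open>P\<close> is arbitrary because the
  lemma is used both for polynomials in \<open>x\<close> and for a step of a filtration.
\<close>

lemma (in field) graded_span_times_power:
  assumes W: "\<forall>i. W i \<subseteq> carrier R" and xy: "x \<in> carrier R" "y \<in> carrier R" "x \<otimes> y = \<one>"
    and P: "\<zero> \<in> P" "\<And>u v. \<lbrakk>u \<in> P; v \<in> P\<rbrakk> \<Longrightarrow> u \<oplus> v \<in> P"
      "\<And>i a. \<lbrakk>0 < i; i \<le> N; a \<in> W i\<rbrakk> \<Longrightarrow> a \<otimes> x [^] (k - i) \<in> P"
    and "N \<le> k" "w \<in> graded_span (W(0 := {\<zero>})) y N"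
  shows "x [^] k \<otimes> w \<in> P"
  using assms(9)
proof induction
  case zero
  then show ?case using P(1) xy by simp
next
  case (step i a w)
  have W'R: "\<forall>i. (W(0 := {\<zero>})) i \<subseteq> carrier R" using W by simp
  have w: "w \<in> carrier R" using graded_span_carrier[OF W'R xy(2)] step by blast
  have a: "a \<in> carrier R" using step(2) W'R by blast
  have "x [^] k \<otimes> (a \<otimes> y [^] i \<oplus> w) = x [^] k \<otimes> (a \<otimes> y [^] i) \<oplus> x [^] k \<otimes> w"
    using a w xy by (simp add: r_distr)
  moreover have "x [^] k \<otimes> (a \<otimes> y [^] i) = a \<otimes> x [^] (k - i)"
  proof -
    have "x [^] k \<otimes> (a \<otimes> y [^] i) = a \<otimes> (x [^] k \<otimes> y [^] i)"
      using a xy by (simp add: m_lcomm)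
    then show ?thesis using pow_mult_inverse_pow[OF xy, of i k] step(1) \<open>N \<le> k\<close> by simp
  qed
  moreover have "a \<otimes> x [^] (k - i) \<in> P"
  proof (cases "i = 0")
    case True
    then show ?thesis using step(2) P(1) xy by simp
  next
    case False
    then show ?thesis using step(1,2) P(3) by simp
  qed
  ultimately show ?case using P(2) step.IH by simp
qed

text \<open>
  The valuative criterion for integral dependence, for a filtration \<open>W\<close> of \<open>S\<close> by ideals; the powers of an
  ideal are the model case. If \<open>z \<noteq> 0\<close> and the ideal of elements \<open>\<Sum> w\<^sub>i z\<^sup>-\<^sup>i\<close> with \<open>i > 0\<close> were proper,
  a valuation ring would contain \<open>u/z\<close> as a non-unit for all \<open>u \<in> W 1\<close>, against the hypothesis. So
  \<open>1 = \<Sum> w\<^sub>i z\<^sup>-\<^sup>i\<close> with \<open>0 < i \<le> N\<close>, that is, \<open>z\<^sup>N = \<Sum> w\<^sub>i z\<^sup>N\<^sup>-\<^sup>i\<close>. This equation of integral dependence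
  is used only through the containment in the conclusion, which follows from it by induction on \<open>k\<close>. The
  defect \<open>N\<close> does not depend on \<open>k\<close>; that is what makes it negligible for large \<open>k\<close>.
\<close>

theorem (in field) valuative_criterion:
  fixes W :: "nat \<Rightarrow> 'a set"
  assumes S: "subring S R" and W: "W 0 = S"
      "\<forall>i. \<forall>a\<in>W i. \<ominus> a \<in> W i" "\<forall>i. \<forall>a\<in>W i. \<forall>b\<in>W i. a \<oplus> b \<in> W i" "\<forall>i. \<zero> \<in> W i"
      "\<forall>i j. \<forall>a\<in>W i. \<forall>b\<in>W j. a \<otimes> b \<in> W (i + j)" "\<And>i j. i \<le> j \<Longrightarrow> W j \<subseteq> W i"
    and z: "z \<in> S"
    and val: "\<And>V. \<lbrakk>valuation_ring R V; S \<subseteq> V\<rbrakk> \<Longrightarrow> \<exists>u\<in>W 1. \<exists>v\<in>V. z = u \<otimes> v"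
  shows "\<exists>N. \<forall>k. z [^] k \<in> W (k - N)"
proof (cases "z = \<zero>")
  case True
  have "z [^] k \<in> W (k - 1)" for k :: nat
  proof (cases k)
    case 0
    then show ?thesis using W(1) subringE(3)[OF S] by simp
  next
    case (Suc n)
    then show ?thesis using True W(4) by (simp add: nat_pow_zero)
  qed
  then show ?thesis by blast
next
  case False
  have WR: "\<forall>i. W i \<subseteq> carrier R" using W(1) W(6)[of 0] subringE(1)[OF S] by auto
  have zR: "z \<in> carrier R" using z subringE(1)[OF S] by blast
  obtain y where y: "y \<in> carrier R" "z \<otimes> y = \<one>" using inverseE[OF zR False] by blast
  have "\<exists>N. \<one> \<in> graded_span (W(0 := {\<zero>})) y N"
  proof (rule ccontr)
    assume "\<nexists>N. \<one> \<in> graded_span (W(0 := {\<zero>})) y N"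
    then obtain V where V: "valuation_ring R V" "S \<subseteq> V"
        "\<And>u v. \<lbrakk>u \<in> W 1; v \<in> V\<rbrakk> \<Longrightarrow> v \<otimes> (u \<otimes> y) \<noteq> \<one>"
      using exists_valuation_ring_inverse[OF S W(1) WR W(2,5,4) y(1)] by metis
    obtain u v where uv: "u \<in> W 1" "v \<in> V" "z = u \<otimes> v" using val V(1,2) by blast
    have "u \<in> carrier R" "v \<in> carrier R" using uv WR valuation_ringE(2)[OF V(1)] by blast+
    then have "v \<otimes> (u \<otimes> y) = z \<otimes> y" using uv(3) y by (simp add: m_ac)
    then show False using V(3)[OF uv(1,2)] y(2) by simp
  qed
  then obtain N where N: "\<one> \<in> graded_span (W(0 := {\<zero>})) y N" by blast
  have "z [^] k \<in> W (k - N)" for k :: nat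
  proof (induction k rule: less_induct)
    case (less k)
    show ?case
    proof (cases "k \<le> N")
      case True
      then show ?thesis using subring_pow_closed[OF S z] W(1) by simp
    next
      case False
      have "z [^] k \<otimes> \<one> \<in> W (k - N)"
      proof (rule graded_span_times_power[OF WR zR y _ _ _ _ N])
        fix i a assume i: "0 < i" "i \<le> N" "a \<in> W i"
        then have "a \<otimes> z [^] (k - i) \<in> W (i + (k - i - N))" using less[of "k - i"] False W(5) by simp
        moreover have "k - N \<le> i + (k - i - N)" by arith
        ultimately show "a \<otimes> z [^] (k - i) \<in> W (k - N)" using W(6) by blast
      qed (use W(3,4) False in auto)
      then show ?thesis using zR by simp
    qed
  qed
  then show ?thesis by blast
qed

lemma (in field) power_span_is_eval:
  assumes A: "subring A R" and x: "x \<in> carrier R" and "w \<in> graded_span (\<lambda>_. A) x N"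
  shows "\<exists>cs. length cs = Suc N \<and> set cs \<subseteq> A \<and> w = eval cs x"
  using assms(3)
proof (induction N arbitrary: w)
  case 0
  note AE = subringE[OF A]
  have "w \<in> A"
    using 0 by induction (use AE x in \<open>auto simp: subset_iff\<close>)
  then show ?case using AE(1) by (intro exI[of _ "[w]"]) (auto simp: subset_iff)
next
  case (Suc N)
  note AE = subringE[OF A]
  obtain a u where au: "a \<in> A" "u \<in> graded_span (\<lambda>_. A) x N" "w = a \<otimes> x [^] Suc N \<oplus> u"
    using graded_span_peel[OF AE(7) AE(2) AE(1) x Suc.prems] by blast
  obtain cs where "length cs = Suc N" "set cs \<subseteq> A" "u = eval cs x" using Suc.IH[OF au(2)] by blast
  then show ?case using au by (intro exI[of _ "a # cs"]) simp
qed

text \<open>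
  If \<open>y = 1/x\<close> lies in \<open>V\<close>, an equation of degree \<open>n + 1\<close> for \<open>x\<close> over \<open>V\<close>, multiplied by \<open>y\<^sup>n\<close>,
  expresses \<open>x\<close> by elements of \<open>V\<close>. The lemma treats the terms of lower degree.
\<close>

lemma (in field) eval_times_inverse_power:
  assumes V: "subring V R" and "x \<in> carrier R" "y \<in> V" "x \<otimes> y = \<one>"
    and "set cs \<subseteq> V" "length cs \<le> Suc k"
  shows "eval cs x \<otimes> y [^] k \<in> V"
  using assms(5,6)
proof (induction cs)
  case Nil
  then show ?case using subringE(1,2)[OF V] assms(3) by (auto simp: subset_iff)
next
  case (Cons c cs)
  note VE = subringE[OF V]
  have y: "y \<in> carrier R" using VE(1) assms(3) by blast
  have cR: "c \<in> carrier R" "eval cs x \<in> carrier R"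
    using Cons.prems VE(1) assms(2) by (auto intro!: eval_in_carrier)
  have "x [^] length cs \<otimes> y [^] k = y [^] (k - length cs)"
    using pow_mult_inverse_pow[of y x "length cs" k] y assms(2,4) Cons.prems(2) by (simp add: m_comm)
  then have "eval (c # cs) x \<otimes> y [^] k = c \<otimes> y [^] (k - length cs) \<oplus> eval cs x \<otimes> y [^] k"
    using cR y assms(2) by (simp add: l_distr m_assoc)
  then show ?case
    using VE(6,7) Cons subring_pow_closed[OF V assms(3)] by simp
qed

text \<open>
  If \<open>x\<close> is not integral over \<open>A\<close>, then \<open>1/x\<close> generates a proper ideal of \<open>A[1/x]\<close>, because a relation
  \<open>1 = \<Sum> a\<^sub>i x\<^sup>-\<^sup>i\<close> with \<open>i > 0\<close> is an integral equation for \<open>x\<close>. So \<open>1/x\<close> is a non-unit of some valuation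
  ring, which does not contain \<open>x\<close>. The description of the integral closure as an intersection of
  valuation rings makes it visible that it is a ring and that it is closed under roots.
\<close>

theorem (in field) integral_iff_in_valuation_rings:
  assumes A: "subring A R" and x: "x \<in> carrier R"
  shows "integral_over R A x \<longleftrightarrow> (\<forall>V. valuation_ring R V \<and> A \<subseteq> V \<longrightarrow> x \<in> V)"
proof
  assume "integral_over R A x"
  then obtain f where f: "f \<noteq> []" "set f \<subseteq> A" "lead_coeff f = \<one>" "eval f x = \<zero>"
    by (auto simp: integral_over_def univ_poly_carrier[symmetric] polynomial_def)
  then obtain cs where cs: "f = \<one> # cs" by (cases f) auto
  show "\<forall>V. valuation_ring R V \<and> A \<subseteq> V \<longrightarrow> x \<in> V"
  proof (intro allI impI, elim conjE)
    fix V assume V: "valuation_ring R V" "A \<subseteq> V"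
    note VE = valuation_ringE[OF V(1)]
    show "x \<in> V"
    proof (rule ccontr)
      assume xV: "x \<notin> V"
      then obtain y where y: "y \<in> carrier R" "x \<otimes> y = \<one>" using inverseE[OF x] VE(3) by metis
      then have yV: "y \<in> V" using VE(8)[OF x] xV by blast
      have csR: "eval cs x \<in> carrier R"
        using f(2) cs subringE(1)[OF A] x by (auto intro!: eval_in_carrier)
      have e: "x [^] length cs \<oplus> eval cs x = \<zero>" using f(4) cs x by simp
      show False
      proof (cases cs)
        case Nil
        then show False using e by simp
      next
        case (Cons c ds)
        define n where "n = length ds"
        have len: "length cs = Suc n" by (simp add: Cons n_def)
        have "eval cs x \<otimes> y [^] n \<in> V"
          using f(2) cs V(2) len by (intro eval_times_inverse_power[OF VE(1) x yV y(2)]) auto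
        moreover have "x = \<ominus> (eval cs x \<otimes> y [^] n)"
        proof -
          have "x [^] Suc n \<otimes> y [^] n = x"
            using pow_mult_inverse_pow[OF x y, of n "Suc n"] x by (simp add: Suc_diff_le)
          moreover have "x [^] Suc n = \<ominus> eval cs x"
            using e csR x unfolding len by (metis minus_equality minus_minus nat_pow_closed)
          ultimately show ?thesis using csR y by (metis l_minus nat_pow_closed)
        qed
        ultimately show False using xV VE(5) by metis
      qed
    qed
  qed
next
  assume all: "\<forall>V. valuation_ring R V \<and> A \<subseteq> V \<longrightarrow> x \<in> V"
  note AE = subringE[OF A]
  show "integral_over R A x"
  proof (cases "x = \<zero>")
    case True
    have "polynomial A [\<one>, \<zero>]" using AE(2,3) by (simp add: polynomial_def)
    then show ?thesis using True unfolding integral_over_def univ_poly_carrier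
      by (intro bexI[of _ "[\<one>, \<zero>]"]) auto
  next
    case False
    obtain y where y: "y \<in> carrier R" "x \<otimes> y = \<one>" using inverseE[OF x False] by blast
    have "\<exists>N. \<one> \<in> graded_span ((\<lambda>_. A)(0 := {\<zero>})) y N"
    proof (rule ccontr)
      assume "\<nexists>N. \<one> \<in> graded_span ((\<lambda>_. A)(0 := {\<zero>})) y N"
      then obtain V where V: "valuation_ring R V" "A \<subseteq> V"
          "\<And>u v. \<lbrakk>u \<in> A; v \<in> V\<rbrakk> \<Longrightarrow> v \<otimes> (u \<otimes> y) \<noteq> \<one>"
        using exists_valuation_ring_inverse[OF A, of "\<lambda>_. A" y] AE y(1) by metis
      then have "x \<in> V" using all by blast
      then show False using V(3)[OF AE(3), of x] y by simp
    qed
    then obtain N where N: "\<one> \<in> graded_span ((\<lambda>_. A)(0 := {\<zero>})) y N" by blast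
    have AR: "\<forall>i::nat. A \<subseteq> carrier R" using AE(1) by simp
    have "N \<noteq> 0"
    proof
      assume "N = 0"
      have "w = \<zero>" if "w \<in> graded_span ((\<lambda>_. A)(0 := {\<zero>})) y 0" for w
        using that by induction (use y in auto)
      then show False using N \<open>N = 0\<close> by (metis one_not_zero)
    qed
    then obtain M where M: "N = Suc M" by (cases N) auto
    have "x [^] N \<otimes> \<one> \<in> graded_span (\<lambda>_. A) x M"
    proof (rule graded_span_times_power[OF AR x y _ _ _ order_refl N])
      show "\<zero> \<in> graded_span (\<lambda>_. A) x M" by (rule graded_span.zero)
      show "u \<oplus> v \<in> graded_span (\<lambda>_. A) x M"
        if "u \<in> graded_span (\<lambda>_. A) x M" "v \<in> graded_span (\<lambda>_. A) x M" for u v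
        using graded_span_add[where W = "\<lambda>_. A", OF AR x] that by blast
      show "a \<otimes> x [^] (N - i) \<in> graded_span (\<lambda>_. A) x M" if "0 < i" "i \<le> N" "a \<in> A" for i a
        using that AE(1) x M by (intro graded_span_single) auto
    qed
    then obtain cs where cs: "length cs = N" "set cs \<subseteq> A" "x [^] N = eval cs x"
      using power_span_is_eval[OF A x, of _ M] x M by auto
    have neg: "set (map (\<lambda>c. \<ominus> c) ds) \<subseteq> A \<and> eval (map (\<lambda>c. \<ominus> c) ds) x = \<ominus> eval ds x"
      if "set ds \<subseteq> A" for ds
      using that
    proof (induction ds)
      case (Cons d ds)
      then have "d \<in> carrier R" "eval ds x \<in> carrier R"
        using AE(1) x by (auto intro!: eval_in_carrier)
      then show ?case using Cons AE(5) x by (simp add: minus_add l_minus)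
    qed simp
    define f where "f = \<one> # map (\<lambda>c. \<ominus> c) cs"
    have "polynomial A f" using neg[OF cs(2)] AE(3) by (auto simp: f_def polynomial_def)
    moreover have "eval f x = x [^] N \<oplus> \<ominus> eval cs x" using neg[OF cs(2)] cs(1) x by (simp add: f_def)
    then have "eval f x = \<zero>" unfolding cs(3)[symmetric] using x by (simp add: r_neg)
    ultimately show ?thesis
      unfolding integral_over_def univ_poly_carrier by (intro bexI[of _ f]) (auto simp: f_def)
  qed
qed

theorem (in field) integral_closure_subring:
  assumes A: "subring A R"
  shows "subring {x \<in> carrier R. integral_over R A x} R"
proof -
  have "{x \<in> carrier R. integral_over R A x} = \<Inter>(insert (carrier R) {V. valuation_ring R V \<and> A \<subseteq> V})"
    using integral_iff_in_valuation_rings[OF A] by auto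
  then show ?thesis
    using valuation_ringE(1) carrier_is_subring by (metis (mono_tags, lifting) insertE insert_not_empty mem_Collect_eq subring_Inter)
qed

lemma (in field) valuation_ring_root_closed:
  fixes n :: nat
  assumes V: "valuation_ring R V" and x: "x \<in> carrier R" and "0 < n" "x [^] n \<in> V"
  shows "x \<in> V"
proof (rule ccontr)
  assume xV: "x \<notin> V"
  note VE = valuation_ringE[OF V]
  obtain y where y: "y \<in> carrier R" "x \<otimes> y = \<one>" using inverseE[OF x] VE(3) xV by metis
  then have yV: "y \<in> V" using VE(8)[OF x] xV by blast
  have "x [^] n \<otimes> y [^] (n - 1) \<in> V" using assms(4) VE(6) subring_pow_closed[OF VE(1) yV] by blast
  then show False using pow_mult_inverse_pow[OF x y, of "n - 1" n] x xV \<open>0 < n\<close> by simp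
qed

lemma (in domain) nat_pow_eq_zero:
  assumes "x \<in> carrier R" "x [^] (n::nat) = \<zero>"
  shows "x = \<zero>"
  using assms(2)
proof (induction n)
  case (Suc n)
  then show ?case using assms(1) integral[of "x [^] n" x] by auto
qed simp

lemma (in field) valuation_ring_power_divides:
  fixes n :: nat
  assumes V: "valuation_ring R V" and x: "x \<in> carrier R" and y: "y \<in> carrier R"
    and n: "0 < n" and w: "w \<in> V" "x [^] n = y [^] n \<otimes> w"
  shows "\<exists>u\<in>V. x = y \<otimes> u"
proof (cases "y = \<zero>")
  case True
  then have "x [^] n = \<zero>" using w n valuation_ringE(2)[OF V] by (auto simp: nat_pow_zero)
  then have "x = \<zero>" using nat_pow_eq_zero[OF x] by blast
  then show ?thesis using True valuation_ringE(3)[OF V] by (intro bexI[of _ \<zero>]) auto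
next
  case False
  then obtain y' where y': "y' \<in> carrier R" "y \<otimes> y' = \<one>" using inverseE[OF y] by blast
  have wR: "w \<in> carrier R" using w(1) valuation_ringE(2)[OF V] by blast
  have "(x \<otimes> y') [^] n = (y [^] n \<otimes> w) \<otimes> y' [^] n" using x y'(1) w(2) by (simp add: nat_pow_distrib)
  also have "\<dots> = (y \<otimes> y') [^] n \<otimes> w" using wR y y'(1) by (simp add: nat_pow_distrib m_ac)
  finally have "(x \<otimes> y') [^] n \<in> V" using y'(2) w(1) wR by simp
  then have "x \<otimes> y' \<in> V" using valuation_ring_root_closed[OF V _ n] x y'(1) by blast
  moreover have "x = y \<otimes> (x \<otimes> y')" using m_lcomm[OF y x y'(1)] x y'(2) by simp
  ultimately show ?thesis by blast
qed

lemma (in field) integral_root: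
  assumes A: "subring A R" and x: "x \<in> carrier R" and "0 < n" "integral_over R A (x [^] (n::nat))"
  shows "integral_over R A x"
  using assms valuation_ring_root_closed[OF _ x \<open>0 < n\<close>] integral_iff_in_valuation_rings[OF A] by simp

section \<open>The Frobenius endomorphism\<close>

lemma (in cring) binomial_expansion:
  assumes a: "a \<in> carrier R" and b: "b \<in> carrier R"
  shows "(a \<oplus> b) [^] (n::nat) = (\<Oplus>i\<in>{..n}. add_pow R (n choose i) (a [^] i \<otimes> b [^] (n - i)))"
proof (induction n)
  case 0
  then show ?case by simp
next
  case (Suc n)
  define f where "f i = a [^] i \<otimes> b [^] (Suc n - i)" for i
  have fR: "f i \<in> carrier R" for i using a b by (simp add: f_def)
  define g where "g i = add_pow R (n choose i) (a [^] i \<otimes> b [^] (n - i))" for i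
  have gR: "g i \<in> carrier R" for i using a b by (simp add: g_def)
  have 1: "(\<Oplus>i\<in>{..n}. g i) \<otimes> b = (\<Oplus>i\<in>{..Suc n}. add_pow R (n choose i) (f i))"
  proof -
    have "(\<Oplus>i\<in>{..n}. g i) \<otimes> b = (\<Oplus>i\<in>{..n}. g i \<otimes> b)"
      using gR b by (intro finsum_ldistr) auto
    also have "\<dots> = (\<Oplus>i\<in>{..n}. add_pow R (n choose i) (f i))"
      using a b by (intro finsum_cong') (auto simp: g_def f_def add_pow_ldistr m_assoc Suc_diff_le fR[unfolded f_def])
    also have "\<dots> = (\<Oplus>i\<in>{..Suc n}. add_pow R (n choose i) (f i))"
      using fR by (simp add: binomial_eq_0)
    finally show ?thesis .
  qed
  have 2: "(\<Oplus>i\<in>{..n}. g i) \<otimes> a = (\<Oplus>i\<in>{..Suc n}. (if i = 0 then \<zero> else add_pow R (n choose (i - 1)) (f i)))"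
  proof -
    have "(\<Oplus>i\<in>{..n}. g i) \<otimes> a = (\<Oplus>i\<in>{..n}. g i \<otimes> a)"
      using gR a by (intro finsum_ldistr) auto
    also have "\<dots> = (\<Oplus>i\<in>{..n}. add_pow R (n choose i) (f (Suc i)))"
      using a b by (intro finsum_cong') (auto simp: g_def f_def add_pow_ldistr add_pow_rdistr m_ac)
    also have "\<dots> = (\<Oplus>i\<in>{..Suc n}. (if i = 0 then \<zero> else add_pow R (n choose (i - 1)) (f i)))"
      using fR by (subst finsum_Suc2) auto
    finally show ?thesis .
  qed
  have "(a \<oplus> b) [^] Suc n = (\<Oplus>i\<in>{..n}. g i) \<otimes> a \<oplus> (\<Oplus>i\<in>{..n}. g i) \<otimes> b"
    using Suc a b gR by (simp add: g_def[symmetric] r_distr)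
  also have "\<dots> = (\<Oplus>i\<in>{..Suc n}. (if i = 0 then \<zero> else add_pow R (n choose (i - 1)) (f i)) \<oplus> add_pow R (n choose i) (f i))"
    unfolding 1 2 using fR by (intro finsum_addf[symmetric]) auto
  also have "\<dots> = (\<Oplus>i\<in>{..Suc n}. add_pow R (Suc n choose i) (f i))"
  proof (intro finsum_cong')
    fix i assume "i \<in> {..Suc n}"
    show "(if i = 0 then \<zero> else add_pow R (n choose (i - 1)) (f i)) \<oplus> add_pow R (n choose i) (f i) = add_pow R (Suc n choose i) (f i)"
      using fR by (cases i) (auto simp: add.nat_pow_mult add.m_comm)
  qed (use fR in auto)
  finally show ?case by (simp only: f_def)
qed

lemma (in cring) frobenius_add:
  assumes p: "Factorial_Ring.prime (p::nat)" and char: "add_pow R p \<one> = \<zero>"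
    and a: "a \<in> carrier R" and b: "b \<in> carrier R"
  shows "(a \<oplus> b) [^] p = a [^] p \<oplus> b [^] p"
proof -
  define f where "f i = add_pow R (p choose i) (a [^] i \<otimes> b [^] (p - i))" for i
  have fR: "f i \<in> carrier R" for i using a b by (simp add: f_def)
  obtain m where m: "p = Suc (Suc m)" using prime_ge_2_nat[OF p] by (metis Suc_le_D numeral_2_eq_2 Suc_le_mono)
  have zero: "f i = \<zero>" if "0 < i" "i < p" for i
  proof -
    have "p dvd (p choose i)" using dvd_choose_prime[of i p] that p by simp
    then obtain k where k: "p choose i = p * k" by blast
    let ?x = "a [^] i \<otimes> b [^] (p - i)"
    have x: "?x \<in> carrier R" using a b by simp
    have "add_pow R p ?x = (add_pow R p \<one>) \<otimes> ?x" using add_pow_ldistr[OF one_closed x, of p] x by simp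
    then have "add_pow R p ?x = \<zero>" using char x by simp
    then show ?thesis unfolding f_def k using x by (simp add: add.nat_pow_pow[symmetric])
  qed
  have "(a \<oplus> b) [^] p = (\<Oplus>i\<in>{..Suc (Suc m)}. f i)"
    unfolding binomial_expansion[OF a b] f_def m ..
  also have "\<dots> = f p \<oplus> ((\<Oplus>i\<in>{..m}. f (Suc i)) \<oplus> f 0)"
    using fR by (subst finsum_Suc, simp, subst finsum_Suc2) (auto simp: m)
  also have "(\<Oplus>i\<in>{..m}. f (Suc i)) = (\<Oplus>i\<in>{..m}. \<zero>)"
    by (intro finsum_cong') (auto simp: zero m)
  also have "f p \<oplus> ((\<Oplus>i\<in>{..m}. \<zero>) \<oplus> f 0) = a [^] p \<oplus> b [^] p"
    using a b by (simp add: f_def finsum_zero)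
  finally show ?thesis .
qed

locale cring_char_p = cring +
  fixes p :: nat
  assumes prime_p: "Factorial_Ring.prime p" and char_p: "add_pow R p \<one> = \<zero>"
begin

lemma frobenius_power_add:
  assumes "a \<in> carrier R" "b \<in> carrier R"
  shows "(a \<oplus> b) [^] (p ^ e) = a [^] (p ^ e) \<oplus> b [^] (p ^ e)"
proof (induction e)
  case 0
  then show ?case using assms by simp
next
  case (Suc e)
  have "(a \<oplus> b) [^] (p ^ Suc e) = ((a \<oplus> b) [^] (p ^ e)) [^] p"
    using assms by (simp add: nat_pow_pow mult.commute)
  also have "\<dots> = (a [^] (p ^ e)) [^] p \<oplus> (b [^] (p ^ e)) [^] p"
    unfolding Suc using assms by (intro frobenius_add[OF prime_p char_p]) auto
  finally show ?case using assms by (simp add: nat_pow_pow mult.commute)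
qed

end

lemma (in cring) idealI_cring:
  assumes "I \<subseteq> carrier R" "\<zero> \<in> I" "\<And>x y. \<lbrakk>x \<in> I; y \<in> I\<rbrakk> \<Longrightarrow> x \<oplus> y \<in> I"
    and mult: "\<And>a x. \<lbrakk>a \<in> carrier R; x \<in> I\<rbrakk> \<Longrightarrow> a \<otimes> x \<in> I"
  shows "ideal I R"
proof (rule idealI[OF ring_axioms])
  show "subgroup I (add_monoid R)"
  proof (rule add.subgroupI)
    fix x assume x: "x \<in> I"
    then have "\<ominus> x = (\<ominus> \<one>) \<otimes> x" using assms(1) by (simp add: subset_iff l_minus)
    then show "\<ominus> x \<in> I" using mult[OF _ x] by simp
  qed (use assms in auto)
  show "x \<otimes> a \<in> I" if "a \<in> I" "x \<in> carrier R" for a x using mult that by blast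
  then show "a \<otimes> x \<in> I" if "a \<in> I" "x \<in> carrier R" for a x
    using that assms(1) by (metis in_mono m_comm)
qed

lemma idealE:
  assumes "ideal I R"
  shows "I \<subseteq> carrier R" "\<zero>\<^bsub>R\<^esub> \<in> I" "\<And>x y. \<lbrakk>x \<in> I; y \<in> I\<rbrakk> \<Longrightarrow> x \<oplus>\<^bsub>R\<^esub> y \<in> I"
    "\<And>a x. \<lbrakk>a \<in> carrier R; x \<in> I\<rbrakk> \<Longrightarrow> a \<otimes>\<^bsub>R\<^esub> x \<in> I" "\<And>x. x \<in> I \<Longrightarrow> \<ominus>\<^bsub>R\<^esub> x \<in> I"
proof -
  interpret ideal I R by (rule assms)
  show "I \<subseteq> carrier R" "\<zero>\<^bsub>R\<^esub> \<in> I" by (simp_all add: a_subset)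
  show "\<And>x y. \<lbrakk>x \<in> I; y \<in> I\<rbrakk> \<Longrightarrow> x \<oplus>\<^bsub>R\<^esub> y \<in> I"
    "\<And>a x. \<lbrakk>a \<in> carrier R; x \<in> I\<rbrakk> \<Longrightarrow> a \<otimes>\<^bsub>R\<^esub> x \<in> I" "\<And>x. x \<in> I \<Longrightarrow> \<ominus>\<^bsub>R\<^esub> x \<in> I"
    by (simp_all add: I_l_closed)
qed

text \<open>
  Since Frobenius is a ring endomorphism, the elements whose \<open>p\<^sup>e\<close>-th power lies in an ideal form an ideal.
  To bound the \<open>p\<^sup>e\<close>-th powers of the elements of an ideal it therefore suffices to look at generators.
\<close>

lemma (in cring_char_p) frobenius_preimage_ideal:
  assumes "ideal K R"
  shows "ideal {x \<in> carrier R. x [^] (p ^ e) \<in> K} R"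
proof (rule idealI_cring)
  have "p ^ e \<noteq> 0" using prime_gt_0_nat[OF prime_p] by simp
  then show "\<zero> \<in> {x \<in> carrier R. x [^] (p ^ e) \<in> K}"
    using idealE(2)[OF assms] by (simp add: nat_pow_zero)
qed (use idealE[OF assms] in \<open>auto simp: frobenius_power_add nat_pow_distrib\<close>)

lemma (in cring_char_p) frobenius_genideal:
  assumes "T \<subseteq> carrier R" "ideal K R" "\<And>x. x \<in> T \<Longrightarrow> x [^] (p ^ e) \<in> K" "x \<in> Idl T"
  shows "x [^] (p ^ e) \<in> K"
  using genideal_minimal[OF frobenius_preimage_ideal[OF assms(2)], of T e] assms(1,3,4) by blast

lemma frobenius_inj:
  assumes "domain R" "cring_char_p R p" "x \<in> carrier R" "y \<in> carrier R"
    and "x [^]\<^bsub>R\<^esub> (p ^ e) = y [^]\<^bsub>R\<^esub> (p ^ e)"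
  shows "x = y"
proof -
  interpret domain R by fact
  interpret cring_char_p R p by fact
  have "(x \<ominus>\<^bsub>R\<^esub> y) [^]\<^bsub>R\<^esub> (p ^ e) \<oplus>\<^bsub>R\<^esub> y [^]\<^bsub>R\<^esub> (p ^ e) = (x \<ominus>\<^bsub>R\<^esub> y \<oplus>\<^bsub>R\<^esub> y) [^]\<^bsub>R\<^esub> (p ^ e)"
    using assms(3,4) by (subst frobenius_power_add) auto
  also have "x \<ominus>\<^bsub>R\<^esub> y \<oplus>\<^bsub>R\<^esub> y = x" using assms(3,4) by (simp add: a_minus_def a_assoc l_neg)
  finally have "(x \<ominus>\<^bsub>R\<^esub> y) [^]\<^bsub>R\<^esub> (p ^ e) = \<zero>\<^bsub>R\<^esub>"
    using assms(3-5) by (simp add: a_minus_def)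
  then have "x \<ominus>\<^bsub>R\<^esub> y = \<zero>\<^bsub>R\<^esub>" using nat_pow_eq_zero[of "x \<ominus>\<^bsub>R\<^esub> y" "p ^ e"] assms(3,4) by simp
  then show ?thesis using assms(3,4) by simp
qed

text \<open>
  For a perfect domain, Frobenius is an automorphism and maps the ideal generated by a set onto the ideal
  generated by its \<open>p\<^sup>e\<close>-th powers. Membership in a Frobenius power can be tested after taking roots.
\<close>

lemma genideal_frobenius_root:
  assumes "domain R" "cring_char_p R p" "T \<subseteq> carrier R" "x \<in> carrier R"
    and roots: "\<And>s. s \<in> carrier R \<Longrightarrow> \<exists>t\<in>carrier R. t [^]\<^bsub>R\<^esub> (p ^ e) = s"
    and x: "x [^]\<^bsub>R\<^esub> (p ^ e) \<in> Idl\<^bsub>R\<^esub> ((\<lambda>y. y [^]\<^bsub>R\<^esub> (p ^ e)) ` T)"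
  shows "x \<in> Idl\<^bsub>R\<^esub> T"
proof -
  interpret domain R by fact
  interpret cring_char_p R p by fact
  note I = idealE[OF genideal_ideal[OF assms(3)]]
  let ?P = "(\<lambda>y. y [^]\<^bsub>R\<^esub> (p ^ e)) ` (Idl\<^bsub>R\<^esub> T)"
  have "ideal ?P R"
  proof (rule idealI_cring)
    show "?P \<subseteq> carrier R" using I(1) by auto
    have "p ^ e \<noteq> 0" using prime_gt_0_nat[OF prime_p] by simp
    then show "\<zero>\<^bsub>R\<^esub> \<in> ?P" using I(2) by (auto simp: nat_pow_zero intro!: image_eqI[of _ _ "\<zero>\<^bsub>R\<^esub>"])
    fix u w assume "u \<in> ?P" "w \<in> ?P"
    then obtain u' w' where "u' \<in> Idl\<^bsub>R\<^esub> T" "w' \<in> Idl\<^bsub>R\<^esub> T" "u = u' [^]\<^bsub>R\<^esub> (p ^ e)" "w = w' [^]\<^bsub>R\<^esub> (p ^ e)"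
      by blast
    then show "u \<oplus>\<^bsub>R\<^esub> w \<in> ?P"
      using I(1,3) by (intro image_eqI[of _ _ "u' \<oplus>\<^bsub>R\<^esub> w'"]) (auto simp: frobenius_power_add subset_iff)
  next
    fix s w assume s: "s \<in> carrier R" and "w \<in> ?P"
    then obtain w' where w: "w' \<in> Idl\<^bsub>R\<^esub> T" "w = w' [^]\<^bsub>R\<^esub> (p ^ e)" by blast
    obtain t where t: "t \<in> carrier R" "t [^]\<^bsub>R\<^esub> (p ^ e) = s" using roots s by blast
    have "s \<otimes>\<^bsub>R\<^esub> w = (t \<otimes>\<^bsub>R\<^esub> w') [^]\<^bsub>R\<^esub> (p ^ e)"
      using t w I(1) by (auto simp: nat_pow_distrib subset_iff)
    then show "s \<otimes>\<^bsub>R\<^esub> w \<in> ?P" using I(4)[OF t(1) w(1)] by blast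
  qed
  then have "Idl\<^bsub>R\<^esub> ((\<lambda>y. y [^]\<^bsub>R\<^esub> (p ^ e)) ` T) \<subseteq> ?P"
    using genideal_self[OF assms(3)] by (intro genideal_minimal) auto
  then obtain y where "y \<in> Idl\<^bsub>R\<^esub> T" "x [^]\<^bsub>R\<^esub> (p ^ e) = y [^]\<^bsub>R\<^esub> (p ^ e)" using x by blast
  then show ?thesis using frobenius_inj[OF assms(1,2,4)] I(1) by blast
qed

section \<open>Powers of finitely generated ideals\<close>

lemma (in cring) genideal_mult:
  assumes "T \<subseteq> carrier R" "Y \<subseteq> carrier R" "ideal K R"
    and XY: "\<And>x y. \<lbrakk>x \<in> T; y \<in> Y\<rbrakk> \<Longrightarrow> x \<otimes> y \<in> K"
    and "a \<in> Idl T" "b \<in> Idl Y"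
  shows "a \<otimes> b \<in> K"
proof -
  note KE = idealE[OF assms(3)]
  have colon: "ideal {b \<in> carrier R. \<forall>x\<in>Z. x \<otimes> b \<in> K} R" if "Z \<subseteq> carrier R" for Z
  proof (rule idealI_cring)
    show "\<zero> \<in> {b \<in> carrier R. \<forall>x\<in>Z. x \<otimes> b \<in> K}" using that KE(2) by (auto simp: subset_iff)
    show "x \<oplus> y \<in> {b \<in> carrier R. \<forall>x\<in>Z. x \<otimes> b \<in> K}"
      if "x \<in> {b \<in> carrier R. \<forall>x\<in>Z. x \<otimes> b \<in> K}" "y \<in> {b \<in> carrier R. \<forall>x\<in>Z. x \<otimes> b \<in> K}" for x y
      using that \<open>Z \<subseteq> carrier R\<close> KE(3) by (auto simp: r_distr subset_iff)
    show "c \<otimes> y \<in> {b \<in> carrier R. \<forall>x\<in>Z. x \<otimes> b \<in> K}"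
      if "c \<in> carrier R" "y \<in> {b \<in> carrier R. \<forall>x\<in>Z. x \<otimes> b \<in> K}" for c y
      using that \<open>Z \<subseteq> carrier R\<close> KE(4) by (auto simp: m_lcomm[of _ c y] subset_iff)
  qed blast
  have b: "x \<otimes> b \<in> K" if "x \<in> T" for x
    using genideal_minimal[OF colon[of T], of Y] assms(1,2,6) XY that by blast
  have bR: "b \<in> carrier R" using assms(2,6) idealE(1)[OF genideal_ideal] by blast
  have "Idl T \<subseteq> {a \<in> carrier R. \<forall>x\<in>{b}. x \<otimes> a \<in> K}"
    using assms(1) b bR by (intro genideal_minimal colon) (auto simp: subset_iff m_comm)
  then show ?thesis using assms(5) bR by (auto simp: m_comm)
qed

context cring begin

lemma ideal_power_0: "ideal_power R I 0 = carrier R"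
  by (simp add: ideal_power_def ideals_set_def)

lemma ideal_power_Suc: "ideal_power R I (Suc n) = ideal_power R I n \<cdot> I"
  by (simp add: ideal_power_def ideals_set_def nat_pow_def)

lemma ideal_power_ideal: "ideal I R \<Longrightarrow> ideal (ideal_power R I n) R"
  by (induction n) (auto simp: ideal_power_0 ideal_power_Suc oneideal ideal_prod_is_ideal)

lemma ideal_power_1: "ideal I R \<Longrightarrow> ideal_power R I 1 = I"
  using ideal_power_Suc[of I 0] ideal_prod_one[of I] ideal_prod_commute[OF oneideal, of I]
  by (simp add: ideal_power_0)

lemma ideal_power_add:
  assumes "ideal I R"
  shows "ideal_power R I (m + n) = ideal_power R I m \<cdot> ideal_power R I n"
proof -
  interpret M: comm_monoid "ideals_set R" by (rule ideals_set_is_comm_monoid)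
  have "I \<in> carrier (ideals_set R)" using assms by (simp add: ideals_set_def)
  moreover have "monoid.mult (ideals_set R) = ideal_prod R" by (simp add: ideals_set_def)
  ultimately show ?thesis unfolding ideal_power_def using M.nat_pow_mult[of I m n] by simp
qed

lemma ideal_power_mult_mem:
  assumes "ideal I R" "x \<in> ideal_power R I m" "y \<in> ideal_power R I n"
  shows "x \<otimes> y \<in> ideal_power R I (m + n)"
  unfolding ideal_power_add[OF assms(1)] using assms(2,3) by (rule ideal_prod.prod)

lemma ideal_power_antimono:
  assumes "ideal I R" "m \<le> n"
  shows "ideal_power R I n \<subseteq> ideal_power R I m"
  using ideal_prod_inter[OF ideal_power_ideal[OF assms(1), of m] ideal_power_ideal[OF assms(1), of "n - m"]]
    ideal_power_add[OF assms(1), of m "n - m"] assms(2) by auto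

lemma ideal_prod_subset:
  assumes "ideal K R" "\<And>x y. \<lbrakk>x \<in> I; y \<in> J\<rbrakk> \<Longrightarrow> x \<otimes> y \<in> K"
  shows "I \<cdot> J \<subseteq> K"
proof
  fix s assume "s \<in> I \<cdot> J"
  then show "s \<in> K" by induction (use assms idealE(3)[OF assms(1)] in auto)
qed

text \<open>
  One generator at a time: with \<open>I\<close> generated by \<open>A\<close>, the power \<open>(I + (g))\<^sup>n\<close> lies in \<open>\<Sum> g\<^sup>i I\<^sup>n\<^sup>-\<^sup>i\<close>.
\<close>

lemma genideal_insert_power_subset:
  assumes A: "A \<subseteq> carrier R" and g: "g \<in> carrier R"
  shows "ideal_power R (Idl (insert g A)) n
           \<subseteq> Idl {g [^] i \<otimes> u | i u. i \<le> n \<and> u \<in> ideal_power R (Idl A) (n - i)}"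
    (is "_ \<subseteq> Idl (?T n)")
proof (induction n)
  case 0
  have "\<one> \<in> ?T 0" by (auto simp: ideal_power_0 intro!: exI[of _ \<one>])
  then have "Idl {\<one>} \<subseteq> Idl (?T 0)"
    using g by (intro subset_Idl_subset) (auto simp: ideal_power_0)
  then show ?case by (simp add: ideal_power_0 genideal_one)
next
  case (Suc n)
  note IA = genideal_ideal[OF A] and PA = idealE(1)[OF ideal_power_ideal[OF genideal_ideal[OF A]]]
  have TR: "?T m \<subseteq> carrier R" for m using g PA by blast
  show ?case
    unfolding ideal_power_Suc
  proof (rule ideal_prod_subset[OF genideal_ideal[OF TR]])
    fix x y assume xy: "x \<in> ideal_power R (Idl (insert g A)) n" "y \<in> Idl (insert g A)"
    show "x \<otimes> y \<in> Idl (?T (Suc n))"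
    proof (rule genideal_mult[OF TR _ genideal_ideal[OF TR]])
      show "x \<in> Idl (?T n)" using xy Suc by blast
      show "y \<in> Idl (insert g A)" by (rule xy)
      show "insert g A \<subseteq> carrier R" using A g by blast
      fix t a assume "t \<in> ?T n" "a \<in> insert g A"
      then obtain i u where t: "t = g [^] i \<otimes> u" "i \<le> n" "u \<in> ideal_power R (Idl A) (n - i)" by blast
      have uR: "u \<in> carrier R" using t(3) PA by blast
      have "t \<otimes> a \<in> ?T (Suc n)"
      proof (cases "a = g")
        case True
        have "t \<otimes> a = g [^] Suc i \<otimes> u" using True t(1) g uR by (simp add: m_ac)
        then show ?thesis using t(2,3) by (intro CollectI exI[of _ "Suc i"] exI[of _ u]) simp
      next
        case False
        then have a: "a \<in> Idl A" using \<open>a \<in> insert g A\<close> genideal_self[OF A] by blast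
        have "u \<otimes> a \<in> ideal_power R (Idl A) (Suc n - i)"
          using ideal_power_mult_mem[OF IA t(3), of a 1] a ideal_power_1[OF IA] t(2)
          by (simp add: Suc_diff_le)
        moreover have "t \<otimes> a = g [^] i \<otimes> (u \<otimes> a)"
          using t(1) g uR a idealE(1)[OF IA] by (auto simp: m_assoc subset_iff)
        ultimately show ?thesis using t(2) by (intro CollectI exI[of _ i] exI[of _ "u \<otimes> a"]) simp
      qed
      then show "t \<otimes> a \<in> Idl (?T (Suc n))" using genideal_self[OF TR] by blast
    qed
  qed
qed

text \<open>
  The pigeonhole principle for monomials in the generators. The exponent has a summand \<open>1\<close> because for
  \<open>A = {}\<close> the zeroth power of the zero ideal is the whole ring.
\<close>

lemma ideal_power_genideal_subset:
  assumes "finite A" "A \<subseteq> carrier R" "ideal K R" "\<And>g. g \<in> A \<Longrightarrow> g [^] (c::nat) \<in> K"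
  shows "ideal_power R (Idl A) (Suc (card A * c)) \<subseteq> K"
  using assms(1,2,4)
proof (induction A)
  case empty
  have "Idl {} \<subseteq> K" using genideal_minimal[OF assms(3)] by blast
  then show ?case using ideal_power_1[OF genideal_ideal[of "{}"]] by simp
next
  case (insert g A)
  then have A: "A \<subseteq> carrier R" and g: "g \<in> carrier R" by auto
  define n where "n = Suc (card (insert g A) * c)"
  note KE = idealE[OF assms(3)] and PA = idealE(1)[OF ideal_power_ideal[OF genideal_ideal[OF A]]]
  have "g [^] i \<otimes> u \<in> K" if iu: "i \<le> n" "u \<in> ideal_power R (Idl A) (n - i)" for i u
  proof (cases "c \<le> i")
    case True
    then have "g [^] i = g [^] (i - c) \<otimes> g [^] c" using g by (simp add: nat_pow_mult)
    then have "g [^] i \<in> K" using insert.prems(2)[of g] KE(4) g by simp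
    then show ?thesis using KE(1,4) PA iu(2) by (metis in_mono m_comm)
  next
    case False
    then have "Suc (card A * c) \<le> n - i" using insert.hyps by (simp add: n_def)
    then have "u \<in> K"
      using ideal_power_antimono[OF genideal_ideal[OF A]] insert.IH A insert.prems(2) iu(2) by blast
    then show ?thesis using KE(4) g by simp
  qed
  then have "Idl {g [^] i \<otimes> u | i u. i \<le> n \<and> u \<in> ideal_power R (Idl A) (n - i)} \<subseteq> K"
    by (intro genideal_minimal[OF assms(3)]) blast
  then show ?case using genideal_insert_power_subset[OF A g, of n] unfolding n_def by blast
qed

end

section \<open>The absolute integral closure in characteristic p\<close>

lemma (in algebraically_closed) root_exists:
  assumes "s \<in> carrier L" "0 < (n::nat)"
  shows "\<exists>t\<in>carrier L. t [^] n = s"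
proof -
  define f where "f = \<one> # (replicate (n - 1) \<zero> @ [\<ominus> s])"
  have f: "f \<in> carrier (poly_ring L)"
    using assms by (auto simp: f_def univ_poly_carrier[symmetric] polynomial_def)
  have "size (roots f) = n"
    using roots_over_carrier[OF f] assms(2) by (simp add: splitted_def f_def)
  then obtain t where "t \<in># roots f" using assms(2) by (metis multiset_nonemptyE size_empty neq0_conv)
  then have t: "t \<in> carrier L" "eval f t = \<zero>" using roots_mem_iff_is_root[OF f] by (auto simp: is_root_def)
  have "eval f t = t [^] n \<oplus> \<ominus> s"
    using assms t(1) eval_replicate[of "[\<ominus> s]" t "n - 1"] by (simp add: f_def)
  then have "t [^] n = s" using t assms(1) by (metis minus_equality minus_minus nat_pow_closed a_inv_closed)
  then show ?thesis using t(1) by blast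
qed

lemma ring_hom_pow:
  fixes n :: nat
  assumes "cring R" "cring S" "f \<in> ring_hom R S" "x \<in> carrier R"
  shows "f (x [^]\<^bsub>R\<^esub> n) = f x [^]\<^bsub>S\<^esub> n"
proof -
  interpret ring_hom_cring R S f using assms(1-3) by (intro ring_hom_cring.intro ring_hom_cring_axioms.intro)
  show ?thesis using assms(4) by simp
qed

lemma ring_hom_preimage_ideal:
  assumes R: "cring R" and S: "cring S" and f: "f \<in> ring_hom R S" and K: "ideal K S"
  shows "ideal {x \<in> carrier R. f x \<in> K} R"
proof -
  interpret R: cring R by fact
  interpret S: cring S by fact
  have "f \<zero>\<^bsub>R\<^esub> = \<zero>\<^bsub>S\<^esub>" by (rule ring_hom_zero[OF f R.ring_axioms S.ring_axioms])
  then show ?thesis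
    using idealE[OF K] ring_hom_closed[OF f] ring_hom_add[OF f] ring_hom_mult[OF f]
    by (intro R.idealI_cring) auto
qed

lemma ring_hom_genideal:
  assumes "cring R" "cring S" "f \<in> ring_hom R S" "ideal K S" "T \<subseteq> carrier R" "f ` T \<subseteq> K"
    and "x \<in> Idl\<^bsub>R\<^esub> T"
  shows "f x \<in> K"
proof -
  interpret R: cring R by fact
  show ?thesis
    using R.genideal_minimal[OF ring_hom_preimage_ideal[OF assms(1-4)], of T] assms(5-7) by blast
qed

lemma ring_hom_cring_char_p:
  assumes "cring_char_p R p" "cring S" "f \<in> ring_hom R S"
  shows "cring_char_p S p"
proof -
  interpret R: cring_char_p R p by fact
  interpret S: cring S by fact
  have hz: "f \<zero>\<^bsub>R\<^esub> = \<zero>\<^bsub>S\<^esub>" by (rule ring_hom_zero[OF assms(3) R.ring_axioms S.ring_axioms])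
  have "f (add_pow R n \<one>\<^bsub>R\<^esub>) = add_pow S n \<one>\<^bsub>S\<^esub>" for n :: nat
    by (induction n) (use hz ring_hom_add[OF assms(3)] ring_hom_one[OF assms(3)] in auto)
  then have "add_pow S p \<one>\<^bsub>S\<^esub> = \<zero>\<^bsub>S\<^esub>" using R.char_p hz by metis
  then show ?thesis using R.prime_p by unfold_locales
qed

text \<open>
  The setting of the comparison: a Noetherian domain of characteristic \<open>p\<close> and its absolute integral closure
  \<open>S\<close>, which is a perfect domain because it is integrally closed in an algebraically closed field.
\<close>

locale char_p_plus_closure = R: noetherian_domain R + R: cring_char_p R p
  for R :: "('a, 'm) ring_scheme" and p :: nat +
  fixes L :: "('l, 'k) ring_scheme" and \<iota> :: "'a \<Rightarrow> 'l"
  assumes closure: "alg_closure_of_fractions R L \<iota>"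
begin

abbreviation S where "S \<equiv> abs_int_closure R L \<iota>"

lemma \<iota>_hom_L: "\<iota> \<in> ring_hom R L"
  using closure by (simp add: alg_closure_of_fractions_def)

sublocale L: algebraically_closed L
proof -
  interpret algebraic_closure L "generate_field L (\<iota> ` carrier R)"
    using closure by (simp add: alg_closure_of_fractions_def)
  show "algebraically_closed L" by (rule algebraically_closed_axioms)
qed

lemma image_subring: "subring (\<iota> ` carrier R) L"
proof -
  interpret ring_hom_ring R L \<iota> by (rule ring_hom_ringI2[OF R.ring_axioms L.ring_axioms \<iota>_hom_L])
  show ?thesis by (rule img_is_subring[OF R.carrier_is_subring])
qed

lemma S_simps [simp]:
  "monoid.mult S = monoid.mult L" "one S = one L" "ring.add S = ring.add L" "ring.zero S = ring.zero L"
  by (simp_all add: abs_int_closure_def)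

lemma S_pow [simp]: "x [^]\<^bsub>S\<^esub> (n::nat) = x [^]\<^bsub>L\<^esub> n"
  by (simp add: nat_pow_def)

lemma S_carrier: "carrier S = {x \<in> carrier L. integral_over L (\<iota> ` carrier R) x}"
  by (simp add: abs_int_closure_def)

lemma S_subring: "subring (carrier S) L"
  unfolding S_carrier by (rule L.integral_closure_subring[OF image_subring])

lemma S_sub: "carrier S \<subseteq> carrier L"
  by (auto simp: S_carrier)

lemma S_eq: "S = L\<lparr>carrier := carrier S\<rparr>"
  by (simp add: abs_int_closure_def)

sublocale S: domain S
  using L.subring_is_domain[OF S_subring] S_eq by simp

lemma \<iota>_hom: "\<iota> \<in> ring_hom R S"
proof (rule ring_hom_memI)
  fix x assume "x \<in> carrier R"
  then show "\<iota> x \<in> carrier S"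
    using ring_hom_closed[OF \<iota>_hom_L] L.integral_iff_in_valuation_rings[OF image_subring]
    by (auto simp: S_carrier)
qed (use ring_hom_mult[OF \<iota>_hom_L] ring_hom_add[OF \<iota>_hom_L] ring_hom_one[OF \<iota>_hom_L] in auto)

lemma \<iota>_S: "x \<in> carrier R \<Longrightarrow> \<iota> x \<in> carrier S"
  by (rule ring_hom_closed[OF \<iota>_hom])

lemma \<iota>_image_S: "I \<subseteq> carrier R \<Longrightarrow> \<iota> ` I \<subseteq> carrier S"
  using \<iota>_S by blast

sublocale S: cring_char_p S p
  by (rule ring_hom_cring_char_p[OF R.cring_char_p_axioms S.cring_axioms \<iota>_hom])

lemma \<iota>_pow: "x \<in> carrier R \<Longrightarrow> \<iota> (x [^]\<^bsub>R\<^esub> (n::nat)) = \<iota> x [^]\<^bsub>L\<^esub> n"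
  using ring_hom_pow[OF R.cring_axioms S.cring_axioms \<iota>_hom] by simp

lemma S_root:
  assumes "s \<in> carrier S" "0 < (n::nat)"
  shows "\<exists>t\<in>carrier S. t [^]\<^bsub>L\<^esub> n = s"
proof -
  obtain t where t: "t \<in> carrier L" "t [^]\<^bsub>L\<^esub> n = s" using L.root_exists assms S_sub by blast
  then have "t \<in> carrier S"
    using L.integral_root[OF image_subring t(1) assms(2)] assms(1) by (simp add: S_carrier)
  then show ?thesis using t(2) by blast
qed

lemma p_pow_pos: "0 < p ^ e"
  using prime_gt_0_nat[OF R.prime_p] by simp

section \<open>Fractional powers and powers of extended ideals\<close>

text \<open>
  The ideal \<open>\<aa>\<^sup>n S\<close>. As \<open>n\<close> varies these ideals form a multiplicative filtration of \<open>S\<close>, to which the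
  valuative criterion applies.
\<close>

definition ext_power :: "'a set \<Rightarrow> nat \<Rightarrow> 'l set" where
  "ext_power \<aa> n = Idl\<^bsub>S\<^esub> (\<iota> ` ideal_power R \<aa> n)"

context
  fixes \<aa> assumes \<aa>: "ideal \<aa> R"
begin

lemma pow_sub: "\<iota> ` ideal_power R \<aa> n \<subseteq> carrier S"
  using idealE(1)[OF R.ideal_power_ideal[OF \<aa>]] \<iota>_image_S by blast

lemma ext_power_ideal: "ideal (ext_power \<aa> n) S"
  unfolding ext_power_def by (rule S.genideal_ideal[OF pow_sub])

lemma ext_power_antimono: "m \<le> n \<Longrightarrow> ext_power \<aa> n \<subseteq> ext_power \<aa> m"
  unfolding ext_power_def
  using S.genideal_self[OF pow_sub[of m]] R.ideal_power_antimono[OF \<aa>, of m n]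
  by (intro S.genideal_minimal[OF S.genideal_ideal[OF pow_sub]]) blast

lemma ext_power_mult:
  assumes "x \<in> ext_power \<aa> m" "y \<in> ext_power \<aa> n"
  shows "x \<otimes>\<^bsub>L\<^esub> y \<in> ext_power \<aa> (m + n)"
proof -
  have "x \<otimes>\<^bsub>S\<^esub> y \<in> ext_power \<aa> (m + n)"
  proof (rule S.genideal_mult[OF pow_sub pow_sub ext_power_ideal])
    fix u w assume "u \<in> \<iota> ` ideal_power R \<aa> m" "w \<in> \<iota> ` ideal_power R \<aa> n"
    then obtain u' w' where u: "u' \<in> ideal_power R \<aa> m" "u = \<iota> u'" and w: "w' \<in> ideal_power R \<aa> n" "w = \<iota> w'"
      by blast
    then have "u \<otimes>\<^bsub>S\<^esub> w = \<iota> (u' \<otimes>\<^bsub>R\<^esub> w')"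
      using ring_hom_mult[OF \<iota>_hom] idealE(1)[OF R.ideal_power_ideal[OF \<aa>]] by (metis in_mono)
    then show "u \<otimes>\<^bsub>S\<^esub> w \<in> ext_power \<aa> (m + n)"
      using R.ideal_power_mult_mem[OF \<aa> u(1) w(1)] S.genideal_self[OF pow_sub] unfolding ext_power_def by blast
  qed (use assms in \<open>simp_all add: ext_power_def\<close>)
  then show ?thesis by simp
qed

lemma ext_power_0: "ext_power \<aa> 0 = carrier S"
proof
  show "ext_power \<aa> 0 \<subseteq> carrier S" by (rule idealE(1)[OF ext_power_ideal])
  have "\<one>\<^bsub>L\<^esub> \<in> \<iota> ` ideal_power R \<aa> 0"
    using ring_hom_one[OF \<iota>_hom] by (auto simp: R.ideal_power_0 intro!: image_eqI[of _ _ "\<one>\<^bsub>R\<^esub>"])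
  then have "\<one>\<^bsub>S\<^esub> \<in> ext_power \<aa> 0"
    using S.genideal_self[OF pow_sub[of 0]] unfolding ext_power_def by auto
  then show "carrier S \<subseteq> ext_power \<aa> 0" using ideal.one_imp_carrier[OF ext_power_ideal] by blast
qed

lemma ext_power_1: "ext_power \<aa> 1 = Idl\<^bsub>S\<^esub> (\<iota> ` \<aa>)"
  unfolding ext_power_def R.ideal_power_1[OF \<aa>] ..

lemma ext_power_pow:
  assumes "y \<in> Idl\<^bsub>S\<^esub> (\<iota> ` \<aa>)"
  shows "y [^]\<^bsub>L\<^esub> (n::nat) \<in> ext_power \<aa> n"
proof (induction n)
  case 0
  then show ?case using S.one_closed by (simp add: ext_power_0)
next
  case (Suc n)
  then show ?case using ext_power_mult[of _ n y 1] assms ext_power_1 by simp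
qed

text \<open>
  For \<open>q = a / b\<close> the definition of the fractional power compares \<open>b v(x)\<close> with \<open>a v(y)\<close> for some \<open>y\<close>,
  that is, it says that \<open>x\<^sup>b\<close> satisfies the valuative criterion for the filtration by the powers of
  \<open>\<aa>\<^sup>a S\<close>. The fraction that witnesses the inequality for one valuation may differ from \<open>a / b\<close>; the
  two are reconciled by taking roots inside the valuation ring.
\<close>

lemma frac_power_pow:
  assumes x: "x \<in> frac_power L S (Idl\<^bsub>S\<^esub> (\<iota> ` \<aa>)) (of_nat a / of_nat b)" and b: "0 < b"
  shows "\<exists>N. \<forall>k. (x [^]\<^bsub>L\<^esub> b) [^]\<^bsub>L\<^esub> k \<in> ext_power \<aa> (a * (k - N))"
proof -
  have xS: "x \<in> carrier S" using x by (simp add: frac_power_def)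
  have IS: "Idl\<^bsub>S\<^esub> (\<iota> ` \<aa>) \<subseteq> carrier S" using idealE(1)[OF ext_power_ideal[of 1]] unfolding ext_power_1 .
  have neg: "\<ominus>\<^bsub>L\<^esub> u \<in> ext_power \<aa> n" if u: "u \<in> ext_power \<aa> n" for u n
  proof -
    have "u \<in> carrier S" using u idealE(1)[OF ext_power_ideal] by blast
    then have uS: "u \<in> carrier L" "\<ominus>\<^bsub>L\<^esub> u = (\<ominus>\<^bsub>L\<^esub> \<one>\<^bsub>L\<^esub>) \<otimes>\<^bsub>L\<^esub> u"
      using S_sub by (auto simp: L.l_minus)
    have "\<ominus>\<^bsub>L\<^esub> \<one>\<^bsub>L\<^esub> \<in> carrier S" using subringE(3,5)[OF S_subring] by blast
    then show ?thesis using idealE(4)[OF ext_power_ideal _ u] uS(2) by simp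
  qed
  have "\<exists>N. \<forall>k. (x [^]\<^bsub>L\<^esub> b) [^]\<^bsub>L\<^esub> k \<in> (\<lambda>j. ext_power \<aa> (a * j)) (k - N)"
  proof (rule L.valuative_criterion[OF S_subring])
    show "ext_power \<aa> (a * 0) = carrier S" by (simp add: ext_power_0)
    show "\<forall>i. \<forall>u\<in>ext_power \<aa> (a * i). \<ominus>\<^bsub>L\<^esub> u \<in> ext_power \<aa> (a * i)" using neg by blast
    show "\<forall>i. \<forall>u\<in>ext_power \<aa> (a * i). \<forall>w\<in>ext_power \<aa> (a * i). u \<oplus>\<^bsub>L\<^esub> w \<in> ext_power \<aa> (a * i)"
      using idealE(3)[OF ext_power_ideal] by simp
    show "\<forall>i. \<zero>\<^bsub>L\<^esub> \<in> ext_power \<aa> (a * i)" using idealE(2)[OF ext_power_ideal] by simp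
    show "\<forall>i j. \<forall>u\<in>ext_power \<aa> (a * i). \<forall>w\<in>ext_power \<aa> (a * j). u \<otimes>\<^bsub>L\<^esub> w \<in> ext_power \<aa> (a * (i + j))"
      using ext_power_mult by (simp add: distrib_left)
    show "ext_power \<aa> (a * j) \<subseteq> ext_power \<aa> (a * i)" if "i \<le> j" for i j
      using that by (intro ext_power_antimono) simp
    show "x [^]\<^bsub>L\<^esub> b \<in> carrier S" using S.nat_pow_closed[OF xS, of b] by simp
    fix V assume V: "valuation_ring L V" "carrier S \<subseteq> V"
    have F: "field L" by (rule L.field_axioms)
    let ?G = "value_group L V" and ?r = "value_order L V" and ?v = "ring_valuation L V"
    interpret v: field_valuation L ?G ?r ?v by (rule ring_valuation_is_valuation[OF F V(1)])
    obtain y where y: "y \<in> Idl\<^bsub>S\<^esub> (\<iota> ` \<aa>)" and "rat_mul_le ?G ?r (of_nat a / of_nat b) (?v y) (?v x)"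
      using x v.field_valuation_axioms ring_valuation_nonneg_on[OF F V(1) V(2)] unfolding frac_power_def by blast
    then obtain m n where mn: "0 < n" "(of_nat a / of_nat b :: rat) = of_nat m / of_nat n"
        "ext_le ?r (ext_nmul ?G m (?v y)) (ext_nmul ?G n (?v x))"
      by (auto simp: rat_mul_le_def)
    have xL: "x \<in> carrier L" and yL: "y \<in> carrier L" using xS y IS S_sub by auto
    have "ext_le ?r (?v (y [^]\<^bsub>L\<^esub> m)) (?v (x [^]\<^bsub>L\<^esub> n))"
      using mn(3) unfolding v.ext_nmul_v[OF xL] v.ext_nmul_v[OF yL] .
    then obtain w where w: "w \<in> V" "x [^]\<^bsub>L\<^esub> n = y [^]\<^bsub>L\<^esub> m \<otimes>\<^bsub>L\<^esub> w"
      using ring_valuation_le_iff[OF F V(1)] xL yL by auto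
    have "(of_nat (a * n) :: rat) = of_nat (m * b)" using mn(1,2) b by (simp add: field_simps)
    then have ab: "a * n = m * b" by (simp only: of_nat_eq_iff)
    have wL: "w \<in> carrier L" using w(1) valuation_ringE(2)[OF V(1)] by blast
    have "(x [^]\<^bsub>L\<^esub> b) [^]\<^bsub>L\<^esub> n = (x [^]\<^bsub>L\<^esub> n) [^]\<^bsub>L\<^esub> b"
      using xL by (simp add: L.nat_pow_pow mult.commute)
    also have "\<dots> = (y [^]\<^bsub>L\<^esub> m) [^]\<^bsub>L\<^esub> b \<otimes>\<^bsub>L\<^esub> w [^]\<^bsub>L\<^esub> b"
      unfolding w(2) using yL wL by (simp add: L.nat_pow_distrib)
    also have "(y [^]\<^bsub>L\<^esub> m) [^]\<^bsub>L\<^esub> b = (y [^]\<^bsub>L\<^esub> a) [^]\<^bsub>L\<^esub> n"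
      using yL by (simp add: L.nat_pow_pow ab)
    finally have "\<exists>u\<in>V. x [^]\<^bsub>L\<^esub> b = y [^]\<^bsub>L\<^esub> a \<otimes>\<^bsub>L\<^esub> u"
      using L.valuation_ring_power_divides[OF V(1) _ _ mn(1) L.subring_pow_closed[OF valuation_ringE(1)[OF V(1)] w(1)]]
        xL yL by simp
    then show "\<exists>u\<in>ext_power \<aa> (a * 1). \<exists>w\<in>V. x [^]\<^bsub>L\<^esub> b = u \<otimes>\<^bsub>L\<^esub> w"
      using ext_power_pow[OF y, of a] by auto
  qed
  then show ?thesis by simp
qed

end

text \<open>
  An element \<open>x\<close> of the fractional power with exponent \<open>a / b > t\<close> satisfies
  \<open>x\<^sup>b\<^sup>k \<in> \<aa>\<^sup>n S\<close> with \<open>n = a (k - N)\<close>. For \<open>k = p\<^sup>e div b\<close> this \<open>n\<close> is at least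
  \<open>(a / b) p\<^sup>e - a (N + 1)\<close>, which exceeds \<open>t p\<^sup>e\<close> once \<open>e\<close> is large. For one large \<open>e\<close> as in the
  hypothesis, the \<open>p\<^sup>e\<close>-th power of \<open>x\<close> thus lies in the extension to \<open>S\<close> of a Frobenius power of \<open>J\<close>,
  and \<open>p\<^sup>e\<close>-th roots can be taken in \<open>S\<close>.
\<close>

theorem frac_power_gt_subset:
  assumes \<aa>: "ideal \<aa> R" and J: "ideal J R" and t: "0 \<le> t"
    and contained: "\<And>k. \<exists>e\<ge>k. \<forall>n. t * real (p ^ e) \<le> real n \<longrightarrow> ideal_power R \<aa> n \<subseteq> frob_power R J (p ^ e)"
  shows "frac_power_gt L S (Idl\<^bsub>S\<^esub> (\<iota> ` \<aa>)) t \<subseteq> Idl\<^bsub>S\<^esub> (\<iota> ` J)"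
proof
  fix x assume "x \<in> frac_power_gt L S (Idl\<^bsub>S\<^esub> (\<iota> ` \<aa>)) t"
  then obtain q where q: "t < real_of_rat q" "x \<in> frac_power L S (Idl\<^bsub>S\<^esub> (\<iota> ` \<aa>)) q"
    by (auto simp: frac_power_gt_def)
  have xS: "x \<in> carrier S" using q(2) by (simp add: frac_power_def)
  have "0 < real_of_rat q" using q(1) t by linarith
  then have "0 < q" by simp
  obtain a' b' where ab': "quotient_of q = (a', b')" by fastforce
  define a b where "a = nat a'" and "b = nat b'"
  have b': "0 < b'" using quotient_of_denom_pos[OF ab'] .
  have "q = of_int a' / of_int b'" using quotient_of_div[OF ab'] .
  moreover from this have "0 < a'" using \<open>0 < q\<close> b' by (simp add: zero_less_divide_iff)
  ultimately have qab: "q = of_nat a / of_nat b" and b: "0 < b"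
    using b' by (simp_all add: a_def b_def of_nat_nat)
  obtain N where N: "\<And>k. (x [^]\<^bsub>L\<^esub> b) [^]\<^bsub>L\<^esub> k \<in> ext_power \<aa> (a * (k - N))"
    using frac_power_pow[OF \<aa> q(2)[unfolded qab] b] by blast
  have qr: "real_of_rat q = real a / real b" by (simp add: qab of_rat_divide)
  \<comment> \<open>for \<open>e \<ge> k0\<close> the slack \<open>(q - t) p\<^sup>e\<close> absorbs the defect \<open>N\<close> and the rounding of \<open>p\<^sup>e / b\<close>\<close>
  define k0 where "k0 = nat \<lceil>real a * (1 + real N) / (real_of_rat q - t)\<rceil>"
  obtain e where e: "k0 \<le> e"
      "\<And>n. t * real (p ^ e) \<le> real n \<Longrightarrow> ideal_power R \<aa> n \<subseteq> frob_power R J (p ^ e)"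
    using contained by blast
  let ?q = "p ^ e"
  have "e < ?q" using prime_gt_1_nat[OF R.prime_p] power_gt_expt[of p e] by simp
  then have "real k0 \<le> real ?q" using e(1) by simp
  moreover have "real a * (1 + real N) / (real_of_rat q - t) \<le> real k0"
    unfolding k0_def by linarith
  ultimately have "real a * (1 + real N) / (real_of_rat q - t) \<le> real ?q" by linarith
  then have large: "real a * (1 + real N) \<le> (real_of_rat q - t) * real ?q"
    using q(1) by (simp add: field_simps)
  define k where "k = ?q div b"
  have "real ?q / real b - 1 \<le> real k"
  proof -
    have "?q = b * k + ?q mod b" by (simp add: k_def)
    moreover have "?q mod b < b" using b by simp
    ultimately have "?q \<le> b * k + b" by linarith
    then have "real ?q \<le> real b * (real k + 1)" by (simp only: of_nat_le_iff[where 'a = real, symmetric] of_nat_add of_nat_mult distrib_left mult_1_right)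
    then show ?thesis using b by (simp add: field_simps)
  qed
  then have "real a * (real ?q / real b - 1 - real N) \<le> real a * real (k - N)"
    by (intro mult_left_mono) auto
  then have "t * real ?q \<le> real a * real (k - N)"
    using large by (simp add: qr algebra_simps)
  then have "t * real ?q \<le> real (a * (k - N))" by (simp only: of_nat_mult)
  note sub = e(2)[OF this]
  have split: "x [^]\<^bsub>L\<^esub> ?q = (x [^]\<^bsub>L\<^esub> b) [^]\<^bsub>L\<^esub> k \<otimes>\<^bsub>L\<^esub> x [^]\<^bsub>L\<^esub> (?q mod b)"
    using xS S_sub by (auto simp: L.nat_pow_pow L.nat_pow_mult k_def)
  have "x [^]\<^bsub>S\<^esub> (?q mod b) \<otimes>\<^bsub>S\<^esub> (x [^]\<^bsub>L\<^esub> b) [^]\<^bsub>L\<^esub> k \<in> ext_power \<aa> (a * (k - N))"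
    by (rule idealE(4)[OF ext_power_ideal[OF \<aa>] S.nat_pow_closed[OF xS] N])
  then have "x [^]\<^bsub>L\<^esub> ?q \<in> ext_power \<aa> (a * (k - N))"
    unfolding split using xS S_sub by (auto simp: L.m_comm)
  moreover have "ext_power \<aa> (a * (k - N)) \<subseteq> Idl\<^bsub>S\<^esub> ((\<lambda>y. y [^]\<^bsub>S\<^esub> ?q) ` \<iota> ` J)"
  proof -
    have JR: "J \<subseteq> carrier R" by (rule idealE(1)[OF J])
    have PS: "(\<lambda>y. y [^]\<^bsub>S\<^esub> ?q) ` \<iota> ` J \<subseteq> carrier S"
      using \<iota>_image_S[OF JR] S.nat_pow_closed by (auto simp del: S_pow)
    have "\<iota> z \<in> Idl\<^bsub>S\<^esub> ((\<lambda>y. y [^]\<^bsub>S\<^esub> ?q) ` \<iota> ` J)" if "z \<in> frob_power R J ?q" for z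
    proof (rule ring_hom_genideal[OF R.cring_axioms S.cring_axioms \<iota>_hom S.genideal_ideal[OF PS]])
      show "z \<in> Idl\<^bsub>R\<^esub> ((\<lambda>x. x [^]\<^bsub>R\<^esub> ?q) ` J)" using that by (simp add: frob_power_def)
      show "(\<lambda>x. x [^]\<^bsub>R\<^esub> ?q) ` J \<subseteq> carrier R" using JR by auto
      have "\<iota> ` (\<lambda>x. x [^]\<^bsub>R\<^esub> ?q) ` J = (\<lambda>y. y [^]\<^bsub>S\<^esub> ?q) ` \<iota> ` J"
        using JR \<iota>_pow by (auto simp: image_image subset_iff intro!: image_cong)
      then show "\<iota> ` (\<lambda>x. x [^]\<^bsub>R\<^esub> ?q) ` J \<subseteq> Idl\<^bsub>S\<^esub> ((\<lambda>y. y [^]\<^bsub>S\<^esub> ?q) ` \<iota> ` J)"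
        using S.genideal_self[OF PS] by simp
    qed
    then show ?thesis
      unfolding ext_power_def using sub by (intro S.genideal_minimal[OF S.genideal_ideal[OF PS]]) blast
  qed
  ultimately have "x [^]\<^bsub>S\<^esub> ?q \<in> Idl\<^bsub>S\<^esub> ((\<lambda>y. y [^]\<^bsub>S\<^esub> ?q) ` \<iota> ` J)" by auto
  moreover have "\<exists>t\<in>carrier S. t [^]\<^bsub>S\<^esub> ?q = s" if "s \<in> carrier S" for s
    using S_root[OF that p_pow_pos] by simp
  ultimately show "x \<in> Idl\<^bsub>S\<^esub> (\<iota> ` J)"
    by (rule genideal_frobenius_root[OF S.domain_axioms S.cring_char_p_axioms
          \<iota>_image_S[OF idealE(1)[OF J]] xS, rotated])
qed

end

section \<open>Valuations of elements of ideal powers\<close>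

context field_valuation begin

lemma v_cases:
  assumes "x \<in> carrier F"
  obtains "v x = None" | g where "g \<in> carrier G" "v x = Some g"
  using assms v_zero v_nonzero[of x] by (cases "x = \<zero>\<^bsub>F\<^esub>") auto

lemma v_le_trans:
  assumes "ext_le r (v x) (v y)" "ext_le r (v y) (v z)"
  shows "ext_le r (v x) (v z)"
  using assms G.linear_order by (auto simp: ext_le_def order_on_defs dest: transD)

lemma v_le_total:
  assumes "x \<in> carrier F" "y \<in> carrier F"
  shows "ext_le r (v x) (v y) \<or> ext_le r (v y) (v x)"
proof -
  have "(g, h) \<in> r \<or> (h, g) \<in> r" if "g \<in> carrier G" "h \<in> carrier G" for g h
    using G.linear_order that by (cases "g = h") (auto simp: order_on_defs total_on_def refl_on_def)
  then show ?thesis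
    by (rule_tac v_cases[OF assms(1)]; rule_tac v_cases[OF assms(2)]) (auto simp: ext_le_def)
qed

lemma v_le_mult:
  assumes "x \<in> carrier F" "y \<in> carrier F" "x' \<in> carrier F" "y' \<in> carrier F"
    and xx': "ext_le r (v x) (v x')" and yy': "ext_le r (v y) (v y')"
  shows "ext_le r (v (x \<otimes>\<^bsub>F\<^esub> y)) (v (x' \<otimes>\<^bsub>F\<^esub> y'))"
proof (cases "v x' = None \<or> v y' = None")
  case True
  then show ?thesis using assms(1-4) by (auto simp: v_mult ext_le_def ext_add_def split: option.splits)
next
  case False
  then obtain g g' h h' where gh: "v x = Some g" "v x' = Some g'" "(g, g') \<in> r"
      "v y = Some h" "v y' = Some h'" "(h, h') \<in> r"
    using xx' yy' by (auto simp: ext_le_def)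
  have "r \<subseteq> carrier G \<times> carrier G" using G.linear_order by (simp add: order_on_defs)
  then have c: "g \<in> carrier G" "g' \<in> carrier G" "h \<in> carrier G" "h' \<in> carrier G" using gh by auto
  have "(g \<otimes>\<^bsub>G\<^esub> h, g' \<otimes>\<^bsub>G\<^esub> h) \<in> r" using G.mult_mono gh(3) c by blast
  moreover have "(g' \<otimes>\<^bsub>G\<^esub> h, g' \<otimes>\<^bsub>G\<^esub> h') \<in> r"
    using G.mult_mono[OF gh(6) c(2)] c by (simp add: G.m_comm)
  ultimately have "(g \<otimes>\<^bsub>G\<^esub> h, g' \<otimes>\<^bsub>G\<^esub> h') \<in> r"
    using G.linear_order by (auto simp: order_on_defs dest: transD)
  then show ?thesis using gh assms(1-4) by (simp add: v_mult ext_le_def ext_add_def)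
qed

lemma v_le_pow:
  fixes n :: nat
  assumes "x \<in> carrier F" "y \<in> carrier F" "ext_le r (v x) (v y)"
  shows "ext_le r (v (x [^]\<^bsub>F\<^esub> n)) (v (y [^]\<^bsub>F\<^esub> n))"
proof (induction n)
  case 0
  then show ?case using v_le_total[of "\<one>\<^bsub>F\<^esub>" "\<one>\<^bsub>F\<^esub>"] by simp
next
  case (Suc n)
  then show ?case using v_le_mult assms by simp
qed

text \<open>
  An element of \<open>\<aa>\<^sup>n\<close> is a sum of products of \<open>n\<close> elements of \<open>\<aa>\<close>, so its value is at least \<open>n v(y)\<close>,
  where \<open>y\<close> is one of the finitely many factors, of smallest value. The induction replaces this choice of a
  minimum: the elements that satisfy the bound for some \<open>y\<close> form an ideal.
\<close>

lemma v_ideal_power_bound: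
  fixes R :: "('a, 'm) ring_scheme"
  assumes R: "cring R" and f: "f \<in> ring_hom R F" and nonneg: "nonneg_on G r v (f ` carrier R)"
    and \<aa>: "ideal \<aa> R" and x: "x \<in> ideal_power R \<aa> n"
  shows "\<exists>y\<in>\<aa>. ext_le r (v (f y [^]\<^bsub>F\<^esub> n)) (v (f x))"
  using x
proof (induction n arbitrary: x)
  case 0
  then have "x \<in> carrier R" using cring.ideal_power_0[OF R] by blast
  then have "ext_le r (v \<one>\<^bsub>F\<^esub>) (v (f x))" using nonneg by (simp add: nonneg_on_def v_one)
  then show ?case using idealE(2)[OF \<aa>] by auto
next
  case (Suc n)
  interpret R: cring R by fact
  note aR = idealE(1)[OF \<aa>]
  have fc: "f z \<in> carrier F" if "z \<in> carrier R" for z using ring_hom_closed[OF f that] .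
  define K where "K = {z \<in> carrier R. \<exists>y\<in>\<aa>. ext_le r (v (f y [^]\<^bsub>F\<^esub> Suc n)) (v (f z))}"
  have "ideal K R"
  proof (rule R.idealI_cring)
    show "K \<subseteq> carrier R" by (auto simp: K_def)
    have "f \<zero>\<^bsub>R\<^esub> = \<zero>\<^bsub>F\<^esub>" by (rule ring_hom_zero[OF f R.ring_axioms F.ring_axioms])
    then show "\<zero>\<^bsub>R\<^esub> \<in> K" using idealE(2)[OF \<aa>] by (auto simp: K_def v_zero ext_le_def)
    fix y z assume "y \<in> K" "z \<in> K"
    then show "y \<oplus>\<^bsub>R\<^esub> z \<in> K"
      using v_add[of "f y" "f z"] fc v_le_trans ring_hom_add[OF f, of y z] unfolding K_def
      by (smt (verit) R.add.m_closed mem_Collect_eq)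
  next
    fix c z assume c: "c \<in> carrier R" and "z \<in> K"
    then obtain y where z: "z \<in> carrier R" "y \<in> \<aa>" "ext_le r (v (f y [^]\<^bsub>F\<^esub> Suc n)) (v (f z))"
      by (auto simp: K_def)
    have "ext_le r (v \<one>\<^bsub>F\<^esub>) (v (f c))" using nonneg c by (simp add: nonneg_on_def v_one)
    moreover have "ext_le r (v (f z)) (v (f z))" using v_le_total[of "f z" "f z"] fc z(1) by blast
    ultimately have "ext_le r (v (\<one>\<^bsub>F\<^esub> \<otimes>\<^bsub>F\<^esub> f z)) (v (f c \<otimes>\<^bsub>F\<^esub> f z))"
      using fc c z(1) by (intro v_le_mult) auto
    then have "ext_le r (v (f z)) (v (f (c \<otimes>\<^bsub>R\<^esub> z)))"
      using fc c z(1) ring_hom_mult[OF f] by simp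
    then show "c \<otimes>\<^bsub>R\<^esub> z \<in> K" using z c v_le_trans unfolding K_def by blast
  qed
  then have "ideal_prod R (ideal_power R \<aa> n) \<aa> \<subseteq> K"
  proof (rule R.ideal_prod_subset)
    fix u w assume u: "u \<in> ideal_power R \<aa> n" and w: "w \<in> \<aa>"
    have uR: "u \<in> carrier R" using idealE(1)[OF R.ideal_power_ideal[OF \<aa>]] u by blast
    have wR: "w \<in> carrier R" using w aR by blast
    obtain y where y: "y \<in> \<aa>" "ext_le r (v (f y [^]\<^bsub>F\<^esub> n)) (v (f u))" using Suc.IH[OF u] by blast
    have yR: "y \<in> carrier R" using y aR by blast
    have "\<exists>z\<in>\<aa>. ext_le r (v (f z [^]\<^bsub>F\<^esub> n)) (v (f u)) \<and> ext_le r (v (f z)) (v (f w))"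
      using v_le_total[OF fc[OF yR] fc[OF wR]]
    proof
      assume "ext_le r (v (f y)) (v (f w))"
      then show ?thesis using y by blast
    next
      assume wy: "ext_le r (v (f w)) (v (f y))"
      have "ext_le r (v (f w [^]\<^bsub>F\<^esub> n)) (v (f u))"
        using v_le_trans[OF v_le_pow[OF fc[OF wR] fc[OF yR] wy] y(2)] .
      moreover have "ext_le r (v (f w)) (v (f w))" using v_le_total[of "f w" "f w"] fc wR by blast
      ultimately show ?thesis using w by blast
    qed
    then obtain z where z: "z \<in> \<aa>" "ext_le r (v (f z [^]\<^bsub>F\<^esub> n)) (v (f u))" "ext_le r (v (f z)) (v (f w))"
      by blast
    have "z \<in> carrier R" using z aR by blast
    then have "ext_le r (v (f z [^]\<^bsub>F\<^esub> n \<otimes>\<^bsub>F\<^esub> f z)) (v (f u \<otimes>\<^bsub>F\<^esub> f w))"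
      using fc uR wR z(2,3) by (intro v_le_mult) auto
    then show "u \<otimes>\<^bsub>R\<^esub> w \<in> K"
      using z(1) uR wR ring_hom_mult[OF f uR wR] unfolding K_def by auto
  qed
  then show ?case using Suc.prems unfolding R.ideal_power_Suc K_def by blast
qed

end

section \<open>Comparison of the thresholds\<close>

lemma (in char_p_plus_closure) root_in_frac_power:
  assumes \<aa>: "ideal \<aa> R" and x: "x \<in> ideal_power R \<aa> n" and s: "s \<in> carrier S"
    and q: "0 < q" "s [^]\<^bsub>L\<^esub> (q::nat) = \<iota> x"
  shows "s \<in> frac_power L S (Idl\<^bsub>S\<^esub> (\<iota> ` \<aa>)) (of_nat n / of_nat q)"
  unfolding frac_power_def
proof (intro CollectI conjI allI impI s, elim conjE)
  fix G :: "'l set monoid" and r v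
  assume "field_valuation L G r v" and nonneg: "nonneg_on G r v (carrier S)"
  then interpret v: field_valuation L G r v by blast
  have aR: "\<aa> \<subseteq> carrier R" by (rule idealE(1)[OF \<aa>])
  have "nonneg_on G r v (\<iota> ` carrier R)" using nonneg \<iota>_S by (auto simp: nonneg_on_def)
  then obtain y where y: "y \<in> \<aa>" "ext_le r (v (\<iota> y [^]\<^bsub>L\<^esub> n)) (v (\<iota> x))"
    using v.v_ideal_power_bound[OF R.cring_axioms \<iota>_hom_L _ \<aa> x] by blast
  have yL: "\<iota> y \<in> carrier L" using y(1) aR \<iota>_S S_sub by blast
  have "ext_le r (ext_nmul G n (v (\<iota> y))) (ext_nmul G q (v s))"
    using y(2) s S_sub yL q(2) by (auto simp: v.ext_nmul_v)
  then have "rat_mul_le G r (of_nat n / of_nat q) (v (\<iota> y)) (v s)"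
    unfolding rat_mul_le_def using q(1) by blast
  moreover have "\<iota> y \<in> Idl\<^bsub>S\<^esub> (\<iota> ` \<aa>)" using S.genideal_self[OF \<iota>_image_S[OF aR]] y(1) by blast
  ultimately show "\<exists>y\<in>Idl\<^bsub>S\<^esub> (\<iota> ` \<aa>). rat_mul_le G r (of_nat n / of_nat q) (v y) (v s)" by blast
qed

text \<open>
  This makes the set in the definition of \<^const>\<open>F_nu\<close> finite, and the ratios whose limit is the
  \<open>F\<close>-threshold bounded.
\<close>

lemma (in noetherian_domain) ideal_power_subset_frob_power:
  assumes \<aa>: "ideal \<aa> R" and J: "ideal J R" and rad: "\<aa> \<subseteq> radical R J"
  shows "\<exists>C. \<forall>q n. 0 < q \<and> C * q \<le> n \<longrightarrow> ideal_power R \<aa> n \<subseteq> frob_power R J q"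
proof -
  obtain A where A: "A \<subseteq> carrier R" "finite A" "\<aa> = Idl A" using finetely_gen[OF \<aa>] by blast
  have "\<forall>g\<in>A. \<exists>n::nat. g [^] n \<in> J"
    using rad genideal_self[OF A(1)] A(3) by (auto simp: radical_def)
  then obtain m :: "_ \<Rightarrow> nat" where m: "\<And>g. g \<in> A \<Longrightarrow> g [^] m g \<in> J" by metis
  define s where "s = (\<Sum>g\<in>A. m g)"
  have s: "g [^] s \<in> J" if g: "g \<in> A" for g
  proof -
    have "m g \<le> s" unfolding s_def using A(2) g by (intro member_le_sum) auto
    then have "g [^] s = g [^] (s - m g) \<otimes> g [^] m g" using A(1) g by (auto simp: nat_pow_mult)
    then show ?thesis using idealE(4)[OF J _ m[OF g]] A(1) g by auto
  qed
  have "ideal_power R \<aa> n \<subseteq> frob_power R J q" if qn: "0 < q" "(card A * s + 1) * q \<le> n" for q n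
  proof -
    have JR: "J \<subseteq> carrier R" by (rule idealE(1)[OF J])
    then have PR: "(\<lambda>x. x [^] q) ` J \<subseteq> carrier R" by auto
    have "ideal_power R (Idl A) (Suc (card A * (s * q))) \<subseteq> frob_power R J q"
    proof (rule ideal_power_genideal_subset[OF A(2,1)])
      show "ideal (frob_power R J q) R" unfolding frob_power_def by (rule genideal_ideal[OF PR])
      fix g assume g: "g \<in> A"
      then have "g [^] (s * q) = (g [^] s) [^] q" using A(1) by (auto simp: nat_pow_pow)
      then show "g [^] (s * q) \<in> frob_power R J q"
        unfolding frob_power_def using genideal_self[OF PR] s[OF g] by auto
    qed
    moreover have "Suc (card A * (s * q)) \<le> n" using qn by (simp add: algebra_simps)
    ultimately show ?thesis using ideal_power_antimono[OF \<aa>, of "Suc (card A * (s * q))" n] A(3) by blast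
  qed
  then show ?thesis by blast
qed

lemma F_nu_properties:
  assumes bound: "\<And>n. C * q \<le> n \<Longrightarrow> ideal_power R \<aa> n \<subseteq> frob_power R J q"
  shows "0 < F_nu R J \<aa> q \<Longrightarrow> \<not> ideal_power R \<aa> (F_nu R J \<aa> q) \<subseteq> frob_power R J q"
    and "F_nu R J \<aa> q < n \<Longrightarrow> ideal_power R \<aa> n \<subseteq> frob_power R J q"
proof -
  define P where "P = {n. 0 < n \<and> \<not> ideal_power R \<aa> n \<subseteq> frob_power R J q}"
  have "n < C * q" if "n \<in> P" for n
    using that bound[of n] unfolding P_def by (metis (mono_tags, lifting) mem_Collect_eq not_le)
  then have "P \<subseteq> {..<C * q}" by blast
  then have fin: "finite P" using finite_subset by blast
  have nu: "F_nu R J \<aa> q = Sup P" by (simp add: F_nu_def P_def)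
  show "\<not> ideal_power R \<aa> (F_nu R J \<aa> q) \<subseteq> frob_power R J q" if "0 < F_nu R J \<aa> q"
  proof -
    have "P \<noteq> {}" using that unfolding nu by (auto simp: Sup_nat_def)
    then have "Sup P \<in> P" using fin by (simp add: cSup_eq_Max)
    then show ?thesis unfolding nu by (simp add: P_def)
  qed
  show "ideal_power R \<aa> n \<subseteq> frob_power R J q" if "F_nu R J \<aa> q < n"
  proof (rule ccontr)
    assume "\<not> ?thesis"
    then have "n \<in> P" using that by (simp add: P_def)
    then have "n \<le> Sup P" using fin by (simp add: le_cSup_finite)
    then show False using that unfolding nu by simp
  qed
qed

theorem theoremA:
  fixes R :: "('a, 'm) ring_scheme" and L :: "('l, 'k) ring_scheme" and B :: "('b, 'n) ring_scheme"
    and \<iota> :: "'a \<Rightarrow> 'l" and \<phi> :: "'l \<Rightarrow> 'b" and \<mm> \<aa> J :: "'a set" and p :: nat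
  assumes "noetherian_domain R" and "local_ring R \<mm>" and "adically_complete R \<mm>"
    and "Factorial_Ring.prime p" and "[p] \<cdot>\<^bsub>R\<^esub> \<one>\<^bsub>R\<^esub> = \<zero>\<^bsub>R\<^esub>" and "F_finite R p"
    and "ideal \<aa> R" and "\<aa> \<noteq> carrier R" and "\<aa> \<noteq> {\<zero>\<^bsub>R\<^esub>}"
    and "ideal J R" and "J \<noteq> carrier R" and "J \<noteq> {\<zero>\<^bsub>R\<^esub>}"
    and "\<aa> \<subseteq> radical R J"
    and "alg_closure_of_fractions R L \<iota>"
    and "\<phi> \<in> ring_hom (abs_int_closure R L \<iota>) B"
    and "bcm_algebra R \<mm> B (\<phi> \<circ> \<iota>)"
    and "captures_tight_closure R p B (\<phi> \<circ> \<iota>)"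
    and "weakly_F_regular R p"
  shows "bcm_threshold L (abs_int_closure R L \<iota>) \<iota> B \<phi> J \<aa> = ennreal (F_threshold R p J \<aa>)"
proof -
  interpret R: noetherian_domain R by (rule assms(1))
  interpret char_p_plus_closure R p L \<iota>
    using assms(1,4,5,14)
    by (intro char_p_plus_closure.intro cring_char_p.intro R.cring_axioms cring_char_p_axioms.intro
        char_p_plus_closure_axioms.intro)
  note \<aa> = assms(7) and J = assms(10) and \<phi> = assms(15)
  interpret B: cring B using assms(16) by (simp add: bcm_algebra_def)
  let ?\<psi> = "\<phi> \<circ> \<iota>"
  have \<psi>: "?\<psi> \<in> ring_hom R B" using assms(16) by (simp add: bcm_algebra_def)
  interpret B: cring_char_p B p
    by (rule ring_hom_cring_char_p[OF R.cring_char_p_axioms B.cring_axioms \<psi>])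
  have JR: "J \<subseteq> carrier R" by (rule idealE(1)[OF J])
  have \<psi>sub: "?\<psi> ` I \<subseteq> carrier B" if "I \<subseteq> carrier R" for I using that ring_hom_closed[OF \<psi>] by blast
  let ?JB = "Idl\<^bsub>B\<^esub> (?\<psi> ` J)" and ?fp = "frac_power_gt L S (Idl\<^bsub>S\<^esub> (\<iota> ` \<aa>))"
  let ?T = "bcm_threshold L S \<iota> B \<phi> J \<aa>"
  define \<nu> where "\<nu> e = F_nu R J \<aa> (p ^ e)" for e
  have PR: "(\<lambda>x. x [^]\<^bsub>R\<^esub> q) ` J \<subseteq> carrier R" for q :: nat using JR by auto

  have lower: "ennreal (real n / real (p ^ e)) \<le> ?T" 
    if not_sub: "\<not> ideal_power R \<aa> n \<subseteq> frob_power R J (p ^ e)" for n e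
  proof (rule ccontr)
    let ?q = "p ^ e"
    \<comment> \<open>the \<open>p\<^sup>e\<close>-th root of an element of \<open>\<aa>\<^sup>n\<close> outside the Frobenius power shows that the
      threshold is at least any \<open>t < n / p\<^sup>e\<close>\<close>
    assume "\<not> ennreal (real n / real ?q) \<le> ?T"
    then obtain c where c: "?T < c" "c < ennreal (real n / real ?q)" by (meson dense not_le)
    then obtain t where t: "0 \<le> t" "c = ennreal t" by (cases c) auto
    then have tn: "t < real n / real ?q" using c(2) by (simp add: ennreal_less_iff)
    obtain x where x: "x \<in> ideal_power R \<aa> n" "x \<notin> frob_power R J ?q" using not_sub by blast
    have frobR: "frob_power R J ?q \<subseteq> carrier R"
      unfolding frob_power_def by (rule idealE(1)[OF R.genideal_ideal[OF PR]])
    have xR: "x \<in> carrier R" using x(1) idealE(1)[OF R.ideal_power_ideal[OF \<aa>]] by blast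
    obtain s where s: "s \<in> carrier S" "s [^]\<^bsub>L\<^esub> ?q = \<iota> x" using S_root[OF \<iota>_S[OF xR] p_pow_pos] by blast
    have "real_of_rat (of_nat n / of_nat ?q) = real n / real ?q"
      by (simp only: of_rat_divide of_rat_of_nat_eq)
    then have "s \<in> ?fp t"
      using root_in_frac_power[OF \<aa> x(1) s(1) p_pow_pos s(2)] tn
      unfolding frac_power_gt_def by (intro UN_I[of "of_nat n / of_nat ?q"]) simp_all
    moreover have "\<phi> s \<notin> ?JB"
    proof
      assume "\<phi> s \<in> ?JB"
      moreover have "u [^]\<^bsub>B\<^esub> ?q \<in> Idl\<^bsub>B\<^esub> (?\<psi> ` frob_power R J ?q)" if u: "u \<in> ?\<psi> ` J" for u
      proof -
        obtain j where j: "j \<in> J" "u = ?\<psi> j" using u by blast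
        then have "u [^]\<^bsub>B\<^esub> ?q = ?\<psi> (j [^]\<^bsub>R\<^esub> ?q)"
          using ring_hom_pow[OF R.cring_axioms B.cring_axioms \<psi>] JR by (metis in_mono)
        moreover have "j [^]\<^bsub>R\<^esub> ?q \<in> frob_power R J ?q"
          unfolding frob_power_def using R.genideal_self[OF PR] j(1) by blast
        ultimately show ?thesis using B.genideal_self[OF \<psi>sub[OF frobR]] by blast
      qed
      ultimately have "\<phi> s [^]\<^bsub>B\<^esub> ?q \<in> Idl\<^bsub>B\<^esub> (?\<psi> ` frob_power R J ?q)"
        using B.frobenius_genideal[OF \<psi>sub[OF JR] B.genideal_ideal[OF \<psi>sub[OF frobR]]] by blast
      moreover have "\<phi> s [^]\<^bsub>B\<^esub> ?q = ?\<psi> x"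
        using ring_hom_pow[OF S.cring_axioms B.cring_axioms \<phi> s(1), of ?q] s(2) by simp
      ultimately have "x \<in> tight_closure R p (frob_power R J ?q)"
        using assms(17) xR R.genideal_ideal[OF PR, of ?q]
        unfolding captures_tight_closure_def frob_power_def by auto
      then have "x \<in> frob_power R J ?q"
        using assms(18) R.genideal_ideal[OF PR, of ?q] unfolding weakly_F_regular_def frob_power_def by blast
      then show False using x(2) by blast
    qed
    ultimately have "c \<le> ?T"
      unfolding bcm_threshold_def t(2) using t(1) by (intro Sup_upper) blast
    then show False using c(1) by simp
  qed

  have upper: "?T \<le> ennreal t" if t: "0 \<le> t"
    and con: "\<And>k. \<exists>e\<ge>k. \<forall>n. t * real (p ^ e) \<le> real n \<longrightarrow> ideal_power R \<aa> n \<subseteq> frob_power R J (p ^ e)" for t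
    unfolding bcm_threshold_def
  proof (rule Sup_least)
    fix c assume "c \<in> {ennreal u | u. 0 \<le> u \<and> \<not> \<phi> ` ?fp u \<subseteq> ?JB}"
    then obtain u where u: "c = ennreal u" "0 \<le> u" "\<not> \<phi> ` ?fp u \<subseteq> ?JB" by blast
    have "\<phi> x \<in> ?JB" if x: "x \<in> ?fp t" for x
    proof (rule ring_hom_genideal[OF S.cring_axioms B.cring_axioms \<phi> B.genideal_ideal[OF \<psi>sub[OF JR]] \<iota>_image_S[OF JR]])
      show "\<phi> ` \<iota> ` J \<subseteq> ?JB" using B.genideal_self[OF \<psi>sub[OF JR]] by (simp add: image_comp)
      show "x \<in> Idl\<^bsub>S\<^esub> (\<iota> ` J)" using frac_power_gt_subset[OF \<aa> J t con] x by blast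
    qed
    then have "\<not> t \<le> u"
      using u(3) frac_power_gt_antimono[of t u L S "Idl\<^bsub>S\<^esub> (\<iota> ` \<aa>)"] by blast
    then show "c \<le> ennreal t" unfolding u(1) by (simp add: ennreal_leI)
  qed

  obtain C where C: "\<And>q n. \<lbrakk>0 < q; C * q \<le> n\<rbrakk> \<Longrightarrow> ideal_power R \<aa> n \<subseteq> frob_power R J q"
    using R.ideal_power_subset_frob_power[OF \<aa> J assms(13)] by blast
  note nu = F_nu_properties[OF C[OF p_pow_pos], folded \<nu>_def]
  have "?T \<le> ennreal (real C)"
  proof (rule upper)
    fix k
    show "\<exists>e\<ge>k. \<forall>n. real C * real (p ^ e) \<le> real n \<longrightarrow> ideal_power R \<aa> n \<subseteq> frob_power R J (p ^ e)"
      using C[OF p_pow_pos] by (intro exI[of _ k]) (simp flip: of_nat_mult of_nat_power)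
  qed simp
  then obtain \<tau> where \<tau>: "0 \<le> \<tau>" "?T = ennreal \<tau>" by (cases ?T) (auto simp: top_unique)
  have "(\<lambda>e. real (\<nu> e) / real (p ^ e)) \<longlonglongrightarrow> \<tau>"
  proof (rule order_tendstoI)
    fix b assume b: "\<tau> < b"
    have "real (\<nu> e) / real (p ^ e) < b" for e
    proof (cases "\<nu> e = 0")
      case False
      then have "ennreal (real (\<nu> e) / real (p ^ e)) \<le> ennreal \<tau>" using lower nu(1) \<tau>(2) by simp
      then show ?thesis using \<tau>(1) b by (simp add: ennreal_le_iff)
    qed (use \<tau>(1) b in simp)
    then show "\<forall>\<^sub>F e in sequentially. real (\<nu> e) / real (p ^ e) < b" by simp
  next
    fix b assume b: "b < \<tau>"
    show "\<forall>\<^sub>F e in sequentially. b < real (\<nu> e) / real (p ^ e)"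
    proof (rule ccontr)
      assume "\<not> ?thesis"
      then have small: "\<exists>e\<ge>k. real (\<nu> e) / real (p ^ e) \<le> b" for k
        by (auto simp: eventually_sequentially not_less)
      obtain e0 where "real (\<nu> e0) / real (p ^ e0) \<le> b" using small by blast
      moreover have "0 \<le> real (\<nu> e0) / real (p ^ e0)" by simp
      ultimately have "0 \<le> b" by linarith
      \<comment> \<open>a \<open>t\<close> above \<open>b\<close> leaves room for the bound \<open>t p\<^sup>e \<le> n\<close> to force \<open>n\<close> above \<open>\<nu> e\<close>\<close>
      define t where "t = (b + \<tau>) / 2"
      have t: "b < t" "t < \<tau>" "0 \<le> t" using b \<open>0 \<le> b\<close> by (simp_all add: t_def)
      have "?T \<le> ennreal t"
      proof (rule upper[OF t(3)])
        fix k
        obtain e where e: "e \<ge> k" "real (\<nu> e) / real (p ^ e) \<le> b" using small by blast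
        have "real (\<nu> e) \<le> b * real (p ^ e)" using e(2) p_pow_pos[of e] by (simp add: divide_le_eq)
        also have "\<dots> < t * real (p ^ e)" using t(1) p_pow_pos[of e] by (intro mult_strict_right_mono) simp_all
        finally have "\<nu> e < n" if "t * real (p ^ e) \<le> real n" for n using that by linarith
        then show "\<exists>e\<ge>k. \<forall>n. t * real (p ^ e) \<le> real n \<longrightarrow> ideal_power R \<aa> n \<subseteq> frob_power R J (p ^ e)"
          using e(1) nu(2) by blast
      qed
      then show False using \<tau> t by (simp add: ennreal_le_iff)
    qed
  qed
  then have "F_threshold R p J \<aa> = \<tau>" unfolding F_threshold_def \<nu>_def by (rule limI)
  then show ?thesis using \<tau>(2) by simp
qed

end
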